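(* The fundamental solution tensor $E$ of the system $$\nabla p=-\Lambda_{\mathrm{DN}}u+f,\qquad\nabla\cdot u=0\qquad\text{on }\mathbb{R}^2$$ (as defined in the context) is given by $$E(x)=\frac{x\otimes x}{2\pi|x|^3}.$$
   Context: Fourier transform on $\mathbb{R}^2$: $\hat u(k)=\int_{\mathbb{R}^2}u(x)e^{-ik\cdot x}dx$, with inverse $u(x)=\frac1{(2\pi)^2}\int_{\mathbb{R}^2}\hat u(k)e^{ik\cdot x}dk$, extended to tempered distributions. $\Lambda_{\mathrm{DN}}$ is the Dirichlet-to-Neumann operator for the harmonic extension to the half-space $\mathbb{R}^2\times(-\infty,0)$, equivalently the Fourier multiplier $\widehat{\Lambda_{\mathrm{DN}}u}(k)=|k|\hat u(k)$. The unknowns are $u:\mathbb{R}^2\to\mathbb{R}^2$ and scalar $p$, with given forcing $f:\mathbb{R}^2\to\mathbb{R}^2$. The fundamental solution tensor $E$ is the $2\times2$-matrix-valued tempered distribution whose Fourier transform is the locally integrable function $\hat E$ characterized by: for each $k\ne0$ and each $\hat f\in\mathbb{C}^2$, the unique pair $(\hat u,\hat p)\in\mathbb{C}^2\times\mathbb{C}$ with $i\hat p\,k=-|k|\hat u+\hat f$ and $\hat u\cdot k=0$ satisfies $\hat u=\hat E(k)\hat f$; so that $u=E*f$. $a\otimes b=(a_ib_j)_{i,j=1,2}$. *)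

theory Defs
  imports "HOL-Analysis.Analysis"
begin

definition partial_deriv :: "'n::finite \<Rightarrow> (real^'n \<Rightarrow> complex) \<Rightarrow> real^'n \<Rightarrow> complex" where
  "partial_deriv i \<phi> x = frechet_derivative \<phi> (at x) (axis i 1)"

fun iter_partial :: "'n::finite list \<Rightarrow> (real^'n \<Rightarrow> complex) \<Rightarrow> real^'n \<Rightarrow> complex" where
  "iter_partial [] \<phi> = \<phi>"
| "iter_partial (i # is) \<phi> = partial_deriv i (iter_partial is \<phi>)"

(* Smoothness is expressed by Frechet differentiability of every iterated partial derivative;
   each of them is then continuous, so this is the usual class of infinitely often
   continuously differentiable functions. *)
definition schwartz :: "(real^'n::finite \<Rightarrow> complex) set" where
  "schwartz = {\<phi>. \<forall>is.
     (\<forall>x. iter_partial is \<phi> differentiable (at x)) \<and>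
     (\<forall>N::nat. bounded (range (\<lambda>x. (1 + norm x) ^ N *\<^sub>R iter_partial is \<phi> x)))}"

definition schwartz_seminorm ::
    "nat \<Rightarrow> 'n::finite list \<Rightarrow> (real^'n \<Rightarrow> complex) \<Rightarrow> real" where
  "schwartz_seminorm N is \<phi> = (SUP x. (1 + norm x) ^ N * norm (iter_partial is \<phi> x))"

definition schwartz_topology :: "(real^'n::finite \<Rightarrow> complex) topology" where
  "schwartz_topology = topology_generated_by
     {{\<psi> \<in> schwartz. schwartz_seminorm N is (\<lambda>x. \<psi> x - \<phi> x) < \<epsilon>} | N is \<phi> \<epsilon>.
        \<phi> \<in> schwartz \<and> \<epsilon> > 0}"

(* A distribution is a functional on all functions of which only the values on Schwartz
   functions are meaningful. *)
type_synonym 'n functional = "(real^'n \<Rightarrow> complex) \<Rightarrow> complex"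

definition tempered_distribution :: "'n::finite functional \<Rightarrow> bool" where
  "tempered_distribution T \<longleftrightarrow>
     (\<forall>\<phi>\<in>schwartz. \<forall>\<psi>\<in>schwartz. T (\<lambda>x. \<phi> x + \<psi> x) = T \<phi> + T \<psi>) \<and>
     (\<forall>c. \<forall>\<phi>\<in>schwartz. T (\<lambda>x. c * \<phi> x) = c * T \<phi>) \<and>
     continuous_map schwartz_topology euclidean T"

definition fourier :: "(real^'n::finite \<Rightarrow> complex) \<Rightarrow> real^'n \<Rightarrow> complex" where
  "fourier \<phi> k = (LINT x|lebesgue. \<phi> x * exp (- (\<i> * complex_of_real (k \<bullet> x))))"

definition fourier_distribution :: "'n::finite functional \<Rightarrow> 'n functional" where
  "fourier_distribution T \<phi> = T (fourier \<phi>)"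

definition locally_integrable :: "(real^'n::finite \<Rightarrow> complex) \<Rightarrow> bool" where
  "locally_integrable g \<longleftrightarrow> (\<forall>K. compact K \<longrightarrow> g absolutely_integrable_on K)"

definition given_by_function ::
    "'n::finite functional \<Rightarrow> (real^'n \<Rightarrow> complex) \<Rightarrow> bool" where
  "given_by_function T g \<longleftrightarrow>
     locally_integrable g \<and>
     (\<forall>\<phi>\<in>schwartz. integrable lebesgue (\<lambda>x. g x * \<phi> x) \<and>
        T \<phi> = (LINT x|lebesgue. g x * \<phi> x))"

definition cvec :: "real^'n \<Rightarrow> complex^'n::finite" where
  "cvec k = (\<chi> j. complex_of_real (k $ j))"

(* The Fourier transform at frequency k of the system grad p = - Lambda_DN u + f, div u = 0.
   The product of u and k in the second equation is bilinear, without conjugation. *)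
definition fourier_system ::
    "real^2 \<Rightarrow> complex^2 \<Rightarrow> complex^2 \<Rightarrow> complex \<Rightarrow> bool" where
  "fourier_system k f u p \<longleftrightarrow>
     (\<i> * p) *s cvec k = - (complex_of_real (norm k) *s u) + f \<and>
     (\<Sum>j\<in>UNIV. u $ j * cvec k $ j) = 0"

(* The value at k = 0 is left free, being irrelevant for the distribution. *)
definition solution_symbol :: "(real^2 \<Rightarrow> complex^2^2) \<Rightarrow> bool" where
  "solution_symbol \<sigma> \<longleftrightarrow>
     (\<forall>k f. k \<noteq> 0 \<longrightarrow>
        (\<exists>!(u, p). fourier_system k f u p) \<and>
        (\<forall>u p. fourier_system k f u p \<longrightarrow> u = \<sigma> k *v f))"

definition fundamental_solution_tensor :: "2 functional^2^2 \<Rightarrow> bool" where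
  "fundamental_solution_tensor E \<longleftrightarrow>
     (\<forall>i j. tempered_distribution (E $ i $ j)) \<and>
     (\<exists>\<sigma>. solution_symbol \<sigma> \<and>
        (\<forall>i j. given_by_function (fourier_distribution (E $ i $ j)) (\<lambda>k. \<sigma> k $ i $ j)))"

definition outer_product :: "real^'n::finite \<Rightarrow> real^'n \<Rightarrow> real^'n^'n" where
  "outer_product a b = (\<chi> i j. a $ i * b $ j)"

end

theory Submission imports Defs "HOL-Probability.Probability" begin

text \<open>
  The symbol of the system is $\delta_{ij}/|k| - k_i k_j/|k|^3$. Both it and the claimed kernel are
  superpositions of Gaussians: with $c = \sqrt{\pi/2}$,
  $c\, x_i x_j/|x|^3 = \int_0^\infty r^2 x_i x_j e^{-r^2|x|^2/2}\,dr$. The Fourier transform of the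
  integrand is $2\pi\,(\delta_{ij}/r^2 - k_i k_j/r^4)\,e^{-|k|^2/(2r^2)}$, and after $r = 1/s$ its
  integral over $r$ is $2\pi c$ times the symbol. Fubini's theorem and the multiplication formula make
  this rigorous when tested against a Schwartz function. Uniqueness holds because the
  Fourier transform maps the Schwartz space onto itself.
\<close>

section \<open>The Schwartz space\<close>

text \<open>Kernel and symbol are both homogeneous of degree -1: in the plane they are locally
  integrable but not integrable, so neither has a transform given by an absolutely convergent
  integral. This is why every identity is tested against a Schwartz function and why the transform
  is moved onto a Gaussian, where it is explicit. The exchange of the r-integral with the space
  integral needs absolute convergence. Bounding |x_i x_j| by |x|^2 and \<delta>_ij by 1 gives
  majorants that are again Gaussian moments in r, with integral of order 1/|x|. The bound C/|x| is
  then the only property of kernel and symbol that local integrability, convergence against test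
  functions and temperedness depend on; integrability of 1/|x| near the origin is itself read off
  from Gaussians.\<close>

lemma borel_measurable_vec_nth [measurable (raw)]:
  "f \<in> borel_measurable M \<Longrightarrow> (\<lambda>x. f x $ i :: real) \<in> borel_measurable M"
  unfolding cart_eq_inner_axis by (intro borel_measurable_inner) simp_all

lemma borel_measurable_cis [measurable (raw)]:
  "f \<in> borel_measurable M \<Longrightarrow> (\<lambda>x. cis (f x)) \<in> borel_measurable M"
  by (erule borel_measurable_continuous_on[rotated]) (intro continuous_intros)

text \<open>Decay without any condition on derivatives. It suffices for integrability and for
  differentiating the transform under the integral, and it lets Gaussians times polynomials take
  part without a proof that they are Schwartz functions.\<close>

definition rapidly_decreasing :: "(real^'n::finite \<Rightarrow> complex) \<Rightarrow> bool" where
  "rapidly_decreasing f \<longleftrightarrow>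
     continuous_on UNIV f \<and> (\<forall>N::nat. \<exists>C. \<forall>x. (1 + norm x) ^ N * norm (f x) \<le> C)"

lemma rapidly_decreasingI:
  assumes "continuous_on UNIV f" "\<And>N::nat. \<exists>C. \<forall>x. (1 + norm x) ^ N * norm (f x) \<le> C"
  shows "rapidly_decreasing f"
  using assms by (auto simp: rapidly_decreasing_def)

lemma rapidly_decreasing_measurable [measurable_dest]:
  "rapidly_decreasing f \<Longrightarrow> f \<in> borel_measurable borel"
  by (simp add: rapidly_decreasing_def borel_measurable_continuous_onI)

lemma rapidly_decreasing_bound:
  assumes "rapidly_decreasing f"
  obtains C where "C > 0" "\<And>x. norm (f x) \<le> C / (1 + norm x) ^ N"
proof -
  obtain C where C: "\<And>x. (1 + norm x) ^ N * norm (f x) \<le> C"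
    using assms by (auto simp: rapidly_decreasing_def)
  have pos: "0 < (1 + norm x) ^ N" for x :: "real^'n"
    by (simp add: add_pos_nonneg)
  show ?thesis
  proof (rule that[of "max C 1"])
    show "norm (f x) \<le> max C 1 / (1 + norm x) ^ N" for x
      using C[of x] pos[of x] by (auto simp: le_divide_eq mult.commute)
  qed simp
qed

lemma rapidly_decreasing_add:
  assumes "rapidly_decreasing f" "rapidly_decreasing g"
  shows "rapidly_decreasing (\<lambda>x. f x + g x)"
proof (rule rapidly_decreasingI)
  show "continuous_on UNIV (\<lambda>x. f x + g x)"
    using assms by (auto simp: rapidly_decreasing_def intro: continuous_on_add)
  fix N :: nat
  obtain C D where CD: "\<And>x. (1 + norm x) ^ N * norm (f x) \<le> C" "\<And>x. (1 + norm x) ^ N * norm (g x) \<le> D"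
    using assms unfolding rapidly_decreasing_def by metis
  have "(1 + norm x) ^ N * norm (f x + g x) \<le> C + D" for x
  proof -
    have "(1 + norm x) ^ N * norm (f x + g x) \<le> (1 + norm x) ^ N * (norm (f x) + norm (g x))"
      by (intro mult_left_mono norm_triangle_ineq) auto
    then show ?thesis using CD[of x] by (simp add: distrib_left)
  qed
  then show "\<exists>C. \<forall>x. (1 + norm x) ^ N * norm (f x + g x) \<le> C" by blast
qed

text \<open>Growth of order \<open>M\<close> is absorbed by using the decay of \<open>f\<close> with
  exponent \<open>N + M\<close>.\<close>

lemma rapidly_decreasing_mult_growth:
  assumes f: "rapidly_decreasing f" and "continuous_on UNIV h"
    and h: "\<And>x. norm (h x) \<le> D * (1 + norm x) ^ M"
  shows "rapidly_decreasing (\<lambda>x. h x * f x)"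
proof (rule rapidly_decreasingI)
  show "continuous_on UNIV (\<lambda>x. h x * f x)"
    using assms by (auto simp: rapidly_decreasing_def intro: continuous_on_mult)
  fix N :: nat
  obtain C where C: "\<And>x. (1 + norm x) ^ (N + M) * norm (f x) \<le> C"
    using f unfolding rapidly_decreasing_def by metis
  \<comment> \<open>At the origin the weight is 1, so \<open>D\<close> bounds a norm there.\<close>
  have D: "D \<ge> 0" using h[of 0] norm_ge_zero[of "h 0"] by (simp del: norm_ge_zero)
  have "(1 + norm x) ^ N * norm (h x * f x) \<le> D * C" for x
  proof -
    have "(1 + norm x) ^ N * norm (h x * f x) \<le> (1 + norm x) ^ N * ((D * (1 + norm x) ^ M) * norm (f x))"
      unfolding norm_mult by (intro mult_left_mono mult_right_mono h) auto
    also have "\<dots> = D * ((1 + norm x) ^ (N + M) * norm (f x))"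
      by (simp add: power_add)
    also have "\<dots> \<le> D * C" by (intro mult_left_mono C D)
    finally show ?thesis .
  qed
  then show "\<exists>C. \<forall>x. (1 + norm x) ^ N * norm (h x * f x) \<le> C" by blast
qed

lemma rapidly_decreasing_cmult:
  "rapidly_decreasing f \<Longrightarrow> rapidly_decreasing (\<lambda>x. c * f x)"
  by (rule rapidly_decreasing_mult_growth[where D = "norm c" and M = 0]) auto

lemma rapidly_decreasing_mult_coord:
  "rapidly_decreasing f \<Longrightarrow> rapidly_decreasing (\<lambda>x. complex_of_real (x $ i) * f x)"
proof (erule rapidly_decreasing_mult_growth[where D = 1 and M = 1])
  show "norm (complex_of_real (x $ i)) \<le> 1 * (1 + norm x) ^ 1" for x :: "real^'a"
    using component_le_norm_cart[of x i] by simp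
qed (intro continuous_intros)

section \<open>Integrals of product functions and of rapidly decreasing functions\<close>

text \<open>\<open>lborel\<close> is the image of the product measure indexed by
  \<open>Basis\<close>, so the integral factors. This serves twice: for a product majorant of
  inverse powers of the norm, and for reducing the Gaussian transform to one dimension.\<close>

lemma integrable_prod_Basis:
  fixes f :: "'a::euclidean_space \<Rightarrow> real \<Rightarrow> 'c::{real_normed_field,banach,second_countable_topology}"
  assumes "\<And>b. b \<in> Basis \<Longrightarrow> integrable lborel (f b)"
  shows "integrable lborel (\<lambda>x::'a. \<Prod>b\<in>Basis. f b (x \<bullet> b))"
    and "(\<integral>x. (\<Prod>b\<in>Basis. f b (x \<bullet> b)) \<partial>lborel) = (\<Prod>b\<in>(Basis::'a set). integral\<^sup>L lborel (f b))"
proof -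
  interpret product_sigma_finite "\<lambda>_::'a. lborel :: real measure"
    by unfold_locales
  have [measurable]: "b \<in> Basis \<Longrightarrow> f b \<in> borel_measurable borel" for b
    using borel_measurable_integrable[OF assms] by simp
  let ?T = "\<lambda>g. \<Sum>b\<in>Basis. g b *\<^sub>R (b::'a)"
  have T: "?T \<in> measurable (\<Pi>\<^sub>M b\<in>Basis. lborel) borel"
    by measurable
  have F: "(\<lambda>x::'a. \<Prod>b\<in>Basis. f b (x \<bullet> b)) \<in> borel_measurable borel"
    by measurable
  have eq: "(\<Prod>b\<in>Basis. f b (?T g \<bullet> b)) = (\<Prod>b\<in>Basis. f b (g b))" for g
    by (intro prod.cong refl) simp
  have lb: "(lborel :: 'a measure) = distr (\<Pi>\<^sub>M b\<in>Basis. lborel) borel ?T"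
    by (rule lborel_eq)
  show "integrable lborel (\<lambda>x::'a. \<Prod>b\<in>Basis. f b (x \<bullet> b))"
    by (subst lb, subst integrable_distr_eq[OF T F]) (simp only: eq product_integrable_prod[OF finite_Basis assms])
  show "(\<integral>x. (\<Prod>b\<in>Basis. f b (x \<bullet> b)) \<partial>lborel) = (\<Prod>b\<in>(Basis::'a set). integral\<^sup>L lborel (f b))"
    by (subst lb, subst integral_distr[OF T F]) (simp only: eq product_integral_prod[OF finite_Basis assms])
qed

text \<open>The exponent gives each coordinate one factor \<open>(1 + norm x)\<^sup>2\<close>, which
  dominates \<open>1 + (x \<bullet> b)\<^sup>2\<close>. The majorant is thus a product of Cauchy
  densities up to a constant, and no polar coordinates are involved.\<close>

lemma integrable_inverse_power_norm:
  "integrable lborel (\<lambda>x::'a::euclidean_space. 1 / (1 + norm x) ^ (2 * DIM('a)))"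
proof (rule Bochner_Integration.integrable_bound)
  have "integrable lborel (\<lambda>x::real. inverse (1 + x\<^sup>2))"
    using integrable_inverse_1_plus_square by (simp add: set_integrable_def)
  then show "integrable lborel (\<lambda>x::'a. \<Prod>b\<in>Basis. inverse (1 + (x \<bullet> b)\<^sup>2))"
    by (rule integrable_prod_Basis(1)[where f = "\<lambda>_ x. inverse (1 + x\<^sup>2)"])
  show "AE x in lborel. norm (1 / (1 + norm (x::'a)) ^ (2 * DIM('a))) \<le> norm (\<Prod>b\<in>Basis. inverse (1 + (x \<bullet> b)\<^sup>2))"
  proof (rule AE_I2)
    fix x :: 'a
    have "(\<Prod>b\<in>(Basis::'a set). inverse ((1 + norm x)\<^sup>2)) \<le> (\<Prod>b\<in>Basis. inverse (1 + (x \<bullet> b)\<^sup>2))"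
    proof (rule prod_mono, intro conjI le_imp_inverse_le)
      fix b :: 'a assume "b \<in> Basis"
      then have "(x \<bullet> b)\<^sup>2 \<le> (norm x)\<^sup>2"
        by (simp add: Basis_le_norm abs_le_square_iff[symmetric])
      then show "1 + (x \<bullet> b)\<^sup>2 \<le> (1 + norm x)\<^sup>2"
        using norm_ge_zero[of x] unfolding power2_sum by (simp add: add_increasing2)
    qed (auto intro: add_pos_nonneg)
    moreover have "(\<Prod>b\<in>(Basis::'a set). inverse ((1 + norm x)\<^sup>2)) = 1 / (1 + norm x) ^ (2 * DIM('a))"
      by (simp add: power_mult power_inverse divide_inverse)
    ultimately show "norm (1 / (1 + norm x) ^ (2 * DIM('a))) \<le> norm (\<Prod>b\<in>Basis. inverse (1 + (x \<bullet> b)\<^sup>2))"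
      by simp
  qed
qed measurable

lemma rapidly_decreasing_integrable:
  assumes "rapidly_decreasing f"
  shows "integrable lborel f"
proof -
  obtain C where C: "C > 0" "\<And>x. norm (f x) \<le> C / (1 + norm x) ^ (2 * DIM(real^'a))"
    using rapidly_decreasing_bound[OF assms] by blast
  show ?thesis
  proof (rule Bochner_Integration.integrable_bound)
    show "integrable lborel (\<lambda>x::real^'a. C * (1 / (1 + norm x) ^ (2 * DIM(real^'a))))"
      by (intro integrable_mult_right integrable_inverse_power_norm)
    show "f \<in> borel_measurable lborel" using assms by measurable
    show "AE x in lborel. norm (f x) \<le> norm (C * (1 / (1 + norm x) ^ (2 * DIM(real^'a))))"
      using C order.trans[OF C(2) abs_ge_self] by (intro AE_I2) simp
  qed
qed

section \<open>Differentiation and closure properties of the Schwartz space\<close>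

lemma partial_deriv_eqI:
  "(f has_derivative f') (at x) \<Longrightarrow> partial_deriv i f x = f' (axis i 1)"
  unfolding partial_deriv_def by (metis frechet_derivative_at)

lemma differentiable_imp_has_derivative:
  "f differentiable (at x) \<Longrightarrow> (f has_derivative frechet_derivative f (at x)) (at x)"
  by (simp add: frechet_derivative_works)

text \<open>Closure properties of the Schwartz space follow by exhibiting a class of functions closed under
  partial differentiation, which avoids Leibniz formulas for iterated derivatives.\<close>
lemma schwartz_coinduct:
  assumes "f \<in> X"
    and decay: "\<And>f. f \<in> X \<Longrightarrow> rapidly_decreasing f"
    and diff: "\<And>f x. f \<in> X \<Longrightarrow> f differentiable (at x)"
    and deriv: "\<And>f i. f \<in> X \<Longrightarrow> partial_deriv i f \<in> X"
  shows "f \<in> schwartz"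
proof -
  have X: "iter_partial is f \<in> X" for "is"
    by (induction "is") (auto simp: \<open>f \<in> X\<close> deriv)
  have "bounded (range (\<lambda>x. (1 + norm x) ^ N *\<^sub>R iter_partial is f x))" for N "is"
    using decay[OF X[of "is"]] unfolding rapidly_decreasing_def
    by (force intro: boundedI)
  then show ?thesis
    using diff[OF X] by (simp add: schwartz_def)
qed

lemma schwartz_differentiable: "f \<in> schwartz \<Longrightarrow> f differentiable (at x)"
  by (metis (mono_tags, lifting) schwartz_def iter_partial.simps(1) mem_Collect_eq)

text \<open>\<open>iter_partial\<close> applies the head of the list last. Appending at the end
  exposes the innermost derivative, so the condition defining \<open>schwartz\<close> passes to
  partial derivatives.\<close>

lemma iter_partial_snoc: "iter_partial (is @ [i]) f = iter_partial is (partial_deriv i f)"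
  by (induction "is") auto

lemma schwartz_partial_deriv: "f \<in> schwartz \<Longrightarrow> partial_deriv i f \<in> schwartz"
  by (auto simp: schwartz_def simp flip: iter_partial_snoc)

lemma schwartz_rapidly_decreasing:
  assumes f: "f \<in> schwartz"
  shows "rapidly_decreasing f"
proof (rule rapidly_decreasingI)
  show "continuous_on UNIV f"
    using schwartz_differentiable[OF f]
    by (intro differentiable_imp_continuous_on) (simp add: differentiable_on_def differentiable_at_withinI)
  fix N :: nat
  have "bounded (range (\<lambda>x. (1 + norm x) ^ N *\<^sub>R iter_partial [] f x))"
    using f by (auto simp only: schwartz_def)
  then obtain C where "\<And>x. norm ((1 + norm x) ^ N *\<^sub>R f x) \<le> C"
    by (auto simp: bounded_iff)
  then show "\<exists>C. \<forall>x. (1 + norm x) ^ N * norm (f x) \<le> C"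
    by (auto simp: abs_mult)
qed

lemma schwartz_add:
  assumes "f \<in> schwartz" "g \<in> schwartz"
  shows "(\<lambda>x. f x + g x) \<in> schwartz"
proof (rule schwartz_coinduct)
  let ?X = "{\<lambda>x. f x + g x | f g. f \<in> schwartz \<and> g \<in> schwartz}"
  show "(\<lambda>x. f x + g x) \<in> ?X" using assms by blast
  fix h assume "h \<in> ?X"
  then obtain f g where h: "h = (\<lambda>x. f x + g x)" and fg: "f \<in> schwartz" "g \<in> schwartz" by blast
  show "rapidly_decreasing h"
    unfolding h by (intro rapidly_decreasing_add schwartz_rapidly_decreasing fg)
  show "h differentiable (at x)" for x
    unfolding h by (intro differentiable_add schwartz_differentiable fg)
  show "partial_deriv i h \<in> ?X" for i
  proof -
    have "partial_deriv i h = (\<lambda>x. partial_deriv i f x + partial_deriv i g x)"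
      unfolding h by (intro ext, subst partial_deriv_eqI, rule has_derivative_add)
        (auto simp: partial_deriv_def intro!: differentiable_imp_has_derivative schwartz_differentiable fg)
    then show ?thesis using fg schwartz_partial_deriv by blast
  qed
qed

lemma schwartz_cmult:
  assumes "f \<in> schwartz"
  shows "(\<lambda>x. c * f x) \<in> schwartz"
proof (rule schwartz_coinduct)
  let ?X = "{\<lambda>x. c * f x | f. f \<in> schwartz}"
  show "(\<lambda>x. c * f x) \<in> ?X" using assms by blast
  fix h assume "h \<in> ?X"
  then obtain f where h: "h = (\<lambda>x. c * f x)" and f: "f \<in> schwartz" by blast
  show "rapidly_decreasing h"
    unfolding h by (intro rapidly_decreasing_cmult schwartz_rapidly_decreasing f)
  show "h differentiable (at x)" for x
    unfolding h by (intro differentiable_mult differentiable_const schwartz_differentiable f)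
  show "partial_deriv i h \<in> ?X" for i
  proof -
    have "partial_deriv i h = (\<lambda>x. c * partial_deriv i f x)"
      unfolding h by (intro ext, subst partial_deriv_eqI, rule has_derivative_mult_right)
        (auto simp: partial_deriv_def intro!: differentiable_imp_has_derivative schwartz_differentiable f)
    then show ?thesis using f schwartz_partial_deriv by blast
  qed
qed

lemma schwartz_diff:
  assumes "f \<in> schwartz" "g \<in> schwartz"
  shows "(\<lambda>x. f x - g x) \<in> schwartz"
  using schwartz_add[OF assms(1) schwartz_cmult[OF assms(2), of "-1"]] by simp

lemma has_derivative_mult_coord:
  fixes g :: "real^'n::finite \<Rightarrow> complex"
  assumes "g differentiable (at x)"
  shows "((\<lambda>x. complex_of_real (x $ j) * g x) has_derivative
     (\<lambda>h. complex_of_real (x $ j) * frechet_derivative g (at x) h + complex_of_real (h $ j) * g x)) (at x)"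
proof -
  have "((\<lambda>x::real^'n. complex_of_real (x $ j)) has_derivative (\<lambda>h. complex_of_real (h $ j))) (at x)"
    by (intro bounded_linear_imp_has_derivative bounded_linear_compose[OF bounded_linear_of_real] bounded_linear_vec_nth)
  from has_derivative_mult[OF this differentiable_imp_has_derivative[OF assms]]
  show ?thesis by simp
qed

lemma schwartz_mult_coord:
  assumes "f \<in> schwartz"
  shows "(\<lambda>x. complex_of_real (x $ j) * f x) \<in> schwartz"
proof (rule schwartz_coinduct)
  \<comment> \<open>The products \<open>x $ j * g x\<close> alone are not closed under
    differentiation: the product rule leaves a term in which the coordinate has been differentiated
    away. The summand \<open>f\<close> absorbs it.\<close>
  let ?X = "{\<lambda>x. f x + complex_of_real (x $ j) * g x | f g. f \<in> schwartz \<and> g \<in> schwartz}"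
  have "(\<lambda>x. 0 * f x + complex_of_real (x $ j) * f x) \<in> ?X"
    using schwartz_cmult[OF assms, of 0] assms unfolding mem_Collect_eq
    by (intro exI[of _ "\<lambda>x. 0 * f x"] exI[of _ f]) simp
  then show "(\<lambda>x. complex_of_real (x $ j) * f x) \<in> ?X" by simp
  fix h assume "h \<in> ?X"
  then obtain f g where h: "h = (\<lambda>x. f x + complex_of_real (x $ j) * g x)"
    and fg: "f \<in> schwartz" "g \<in> schwartz" by blast
  show "rapidly_decreasing h"
    unfolding h by (intro rapidly_decreasing_add rapidly_decreasing_mult_coord schwartz_rapidly_decreasing fg)
  have d: "(h has_derivative (\<lambda>v. frechet_derivative f (at x) v +
      (complex_of_real (x $ j) * frechet_derivative g (at x) v + complex_of_real (v $ j) * g x))) (at x)" for x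
    unfolding h by (intro has_derivative_add has_derivative_mult_coord differentiable_imp_has_derivative
      schwartz_differentiable fg)
  then show "h differentiable (at x)" for x
    by (auto simp: differentiable_def)
  show "partial_deriv i h \<in> ?X" for i
  proof -
    have "partial_deriv i h = (\<lambda>x. (partial_deriv i f x + complex_of_real (axis i 1 $ j) * g x)
        + complex_of_real (x $ j) * partial_deriv i g x)"
      by (intro ext, subst partial_deriv_eqI[OF d]) (simp add: partial_deriv_def algebra_simps)
    then show ?thesis unfolding mem_Collect_eq
      by (intro exI conjI) (assumption, intro schwartz_add schwartz_partial_deriv schwartz_cmult fg, intro schwartz_partial_deriv fg)
  qed
qed

section \<open>The Fourier transform\<close>

lemma has_vector_derivative_imp_difference_quotient:
  assumes "(f has_vector_derivative D) (at x)"
  shows "((\<lambda>h. inverse h *\<^sub>R (f (x + h) - f x)) \<longlongrightarrow> D) (at 0)"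
proof -
  have "((\<lambda>h. norm (f (x + h) - f x - h *\<^sub>R D) / norm h) \<longlongrightarrow> 0) (at 0)"
    using assms by (simp add: has_vector_derivative_def has_derivative_at)
  moreover have "\<forall>\<^sub>F h in at 0. norm (f (x + h) - f x - h *\<^sub>R D) / norm h = norm (inverse h *\<^sub>R (f (x + h) - f x) - D)"
  proof (rule eventually_at_filter[THEN iffD2, OF always_eventually], intro allI impI)
    fix h :: real assume "h \<noteq> 0"
    then have "inverse h *\<^sub>R (f (x + h) - f x) - D = inverse h *\<^sub>R (f (x + h) - f x - h *\<^sub>R D)"
      by (simp add: scaleR_diff_right)
    then show "norm (f (x + h) - f x - h *\<^sub>R D) / norm h = norm (inverse h *\<^sub>R (f (x + h) - f x) - D)"
      by (simp add: divide_inverse mult.commute)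
  qed
  ultimately have "((\<lambda>h. norm (inverse h *\<^sub>R (f (x + h) - f x) - D)) \<longlongrightarrow> 0) (at 0)"
    by (rule Lim_transform_eventually)
  then show ?thesis
    by (simp add: tendsto_norm_zero_iff LIM_zero_iff)
qed

text \<open>\<open>fourier\<close> is defined by an integral over \<open>lebesgue\<close>, while
  Fubini, translation and scaling are applied over \<open>lborel\<close>. For Borel functions both
  integrals agree.\<close>

lemma fourier_eq_lborel:
  assumes "f \<in> borel_measurable borel"
  shows "fourier f k = (\<integral>x. f x * cis (- (k \<bullet> x)) \<partial>lborel)"
proof -
  note [measurable] = assms
  have "fourier f k = (\<integral>x. f x * cis (- (k \<bullet> x)) \<partial>lebesgue)"
    by (simp add: fourier_def cis_conv_exp)
  also have "\<dots> = (\<integral>x. f x * cis (- (k \<bullet> x)) \<partial>lborel)"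
    by (rule integral_completion) measurable
  finally show ?thesis .
qed

lemma integrable_mult_cis:
  assumes "integrable M f" "(\<lambda>x. h x) \<in> borel_measurable M"
  shows "integrable M (\<lambda>x. f x * cis (h x))"
proof (rule Bochner_Integration.integrable_bound[OF assms(1)])
  show "(\<lambda>x. f x * cis (h x)) \<in> borel_measurable M"
    using assms by measurable
qed (simp add: norm_mult)

lemma norm_cis_minus_linear: "norm (cis t - 1 - \<i> * complex_of_real t) \<le> t\<^sup>2 / 2"
  using iexp_approx1[of t 1] by (simp add: cis_conv_exp algebra_simps power2_eq_square)

lemma rapidly_decreasing_norm_power_integrable:
  assumes "rapidly_decreasing f"
  shows "integrable lborel (\<lambda>x. norm x ^ m * norm (f x))"
proof -
  have "rapidly_decreasing (\<lambda>x. complex_of_real (norm x ^ m) * f x)"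
  proof (rule rapidly_decreasing_mult_growth[OF assms, where D = 1 and M = m])
    show "norm (complex_of_real (norm x ^ m)) \<le> 1 * (1 + norm x) ^ m" for x :: "real^'a"
      by (simp add: power_mono norm_power)
  qed (intro continuous_intros)
  from integrable_norm[OF rapidly_decreasing_integrable[OF this]]
  show ?thesis by (simp add: norm_mult norm_power)
qed

text \<open>The candidate is obtained by differentiating under the integral. The Taylor bound on
  \<open>cis\<close> makes the remainder at most |y - k|^2 times the second absolute moment of
  \<open>f\<close>, so no limit theorem for integrals is called for.\<close>

lemma fourier_has_derivative:
  assumes f: "rapidly_decreasing f"
  shows "(fourier f has_derivative
    (\<lambda>h. \<integral>x. f x * cis (- (k \<bullet> x)) * (- \<i> * complex_of_real (h \<bullet> x)) \<partial>lborel)) (at k)"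
proof (rule has_derivativeI_sandwich)
  let ?D = "\<lambda>h. \<integral>x. f x * cis (- (k \<bullet> x)) * (- \<i> * complex_of_real (h \<bullet> x)) \<partial>lborel"
  have [measurable]: "f \<in> borel_measurable borel" using f by measurable
  note int1 = rapidly_decreasing_norm_power_integrable[OF f, of 1]
  note int2 = rapidly_decreasing_norm_power_integrable[OF f, of 2]
  have bound: "norm (f x * cis (- (k \<bullet> x)) * (- \<i> * complex_of_real (h \<bullet> x))) \<le> norm h * (norm x ^ 1 * norm (f x))" for h x
    using mult_right_mono[OF Cauchy_Schwarz_ineq2[of h x] norm_ge_zero[of "f x"]]
    by (simp add: norm_mult mult_ac)
  have intD: "integrable lborel (\<lambda>x. f x * cis (- (k \<bullet> x)) * (- \<i> * complex_of_real (h \<bullet> x)))" for h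
    by (rule Bochner_Integration.integrable_bound[OF integrable_mult_right[OF int1, of "norm h"]])
       (measurable, use bound order.trans[OF bound abs_ge_self] in auto)
  show "bounded_linear ?D"
  proof (rule bounded_linear_intro[where K = "\<integral>x. norm x ^ 1 * norm (f x) \<partial>lborel"])
    show "?D (h + h') = ?D h + ?D h'" for h h'
      by (subst Bochner_Integration.integral_add[symmetric, OF intD intD])
         (simp add: inner_add_left algebra_simps)
    show "?D (r *\<^sub>R h) = r *\<^sub>R ?D h" for r h
      by (subst integral_scaleR_right[symmetric]) (simp add: scaleR_conv_of_real[where 'a = complex] mult_ac)
    show "norm (?D h) \<le> norm h * (\<integral>x. norm x ^ 1 * norm (f x) \<partial>lborel)" for h
    proof -
      have "norm (?D h) \<le> (\<integral>x. norm h * (norm x ^ 1 * norm (f x)) \<partial>lborel)"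
        by (rule Bochner_Integration.integral_norm_bound_integral[OF intD integrable_mult_right[OF int1] bound])
      then show ?thesis by simp
    qed
  qed
  show "(0::real) < 1" by simp
  \<comment> \<open>The quadratic remainder bound after division by \<open>norm (y - k)\<close>; the
    factor 1/2 from Taylor is dropped.\<close>
  let ?H = "\<lambda>y. norm (y - k) * (\<integral>x. norm x ^ 2 * norm (f x) \<partial>lborel)"
  have intF: "integrable lborel (\<lambda>x. f x * cis (- (y \<bullet> x)))" for y
    by (intro integrable_mult_cis rapidly_decreasing_integrable f) measurable
  show "norm (fourier f y - fourier f k - ?D (y - k)) / norm (y - k) \<le> ?H y" if "y \<noteq> k" for y
  proof -
    have pt: "f x * cis (- (y \<bullet> x)) - f x * cis (- (k \<bullet> x))
         - f x * cis (- (k \<bullet> x)) * (- \<i> * complex_of_real ((y - k) \<bullet> x))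
       = f x * cis (- (k \<bullet> x)) * (cis (- ((y - k) \<bullet> x)) - 1 - \<i> * complex_of_real (- ((y - k) \<bullet> x)))" for x
    proof -
      have "cis (- (y \<bullet> x)) = cis (- (k \<bullet> x)) * cis (- ((y - k) \<bullet> x))"
        by (simp add: cis_mult inner_diff_left)
      then show ?thesis by (simp add: algebra_simps)
    qed
    have eq: "fourier f y - fourier f k - ?D (y - k) =
      (\<integral>x. f x * cis (- (k \<bullet> x)) * (cis (- ((y - k) \<bullet> x)) - 1 - \<i> * complex_of_real (- ((y - k) \<bullet> x))) \<partial>lborel)"
      unfolding pt[symmetric]
      by (simp only: fourier_eq_lborel \<open>f \<in> borel_measurable borel\<close>
          Bochner_Integration.integral_diff intF intD Bochner_Integration.integrable_diff)
    have "norm (fourier f y - fourier f k - ?D (y - k)) \<le> (\<integral>x. (norm (y - k))\<^sup>2 * (norm x ^ 2 * norm (f x)) \<partial>lborel)"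
      unfolding eq
    proof (rule Bochner_Integration.integral_norm_bound_integral)
      show "integrable lborel (\<lambda>x. f x * cis (- (k \<bullet> x)) * (cis (- ((y - k) \<bullet> x)) - 1 - \<i> * complex_of_real (- ((y - k) \<bullet> x))))"
        unfolding pt[symmetric] by (intro Bochner_Integration.integrable_diff intF intD)
      show "integrable lborel (\<lambda>x. (norm (y - k))\<^sup>2 * (norm x ^ 2 * norm (f x)))"
        by (intro integrable_mult_right int2)
      fix x
      have "((y - k) \<bullet> x)\<^sup>2 / 2 \<le> (norm (y - k) * norm x)\<^sup>2"
        using power_mono[OF Cauchy_Schwarz_ineq2[of "y - k" x], of 2] zero_le_power2[of "norm (y - k) * norm x"]
        unfolding power2_abs by linarith
      then have "norm (cis (- ((y - k) \<bullet> x)) - 1 - \<i> * complex_of_real (- ((y - k) \<bullet> x))) \<le> (norm (y - k) * norm x)\<^sup>2"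
        using norm_cis_minus_linear[of "- ((y - k) \<bullet> x)"] by simp
      from mult_left_mono[OF this norm_ge_zero[of "f x"]]
      show "norm (f x * cis (- (k \<bullet> x)) * (cis (- ((y - k) \<bullet> x)) - 1 - \<i> * complex_of_real (- ((y - k) \<bullet> x))))
         \<le> (norm (y - k))\<^sup>2 * (norm x ^ 2 * norm (f x))"
        by (simp add: norm_mult power_mult_distrib mult_ac)
    qed
    then have "norm (fourier f y - fourier f k - ?D (y - k)) / norm (y - k)
        \<le> ((norm (y - k))\<^sup>2 * (\<integral>x. norm x ^ 2 * norm (f x) \<partial>lborel)) / norm (y - k)"
      unfolding integral_mult_right_zero by (rule divide_right_mono) simp
    also have "\<dots> = ?H y"
      using that by (simp only: power2_eq_square) simp
    finally show ?thesis .
  qed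
  have "(?H \<longlongrightarrow> norm (k - k) * (\<integral>x. norm x ^ 2 * norm (f x) \<partial>lborel)) (at k)"
    by (intro tendsto_intros)
  then show "(?H \<longlongrightarrow> 0) (at k)" by simp
qed

lemma partial_deriv_fourier:
  assumes "rapidly_decreasing f"
  shows "partial_deriv j (fourier f) = fourier (\<lambda>x. - \<i> * (complex_of_real (x $ j) * f x))"
proof
  fix k
  have "(\<lambda>x. - \<i> * (complex_of_real (x $ j) * f x)) \<in> borel_measurable borel"
    using rapidly_decreasing_cmult[OF rapidly_decreasing_mult_coord[OF assms]] by measurable
  then show "partial_deriv j (fourier f) k = fourier (\<lambda>x. - \<i> * (complex_of_real (x $ j) * f x)) k"
    by (subst partial_deriv_eqI[OF fourier_has_derivative[OF assms]])
       (simp add: fourier_eq_lborel inner_axis' mult_ac)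
qed

lemma norm_fourier_le:
  assumes "f \<in> borel_measurable borel"
  shows "norm (fourier f k) \<le> (\<integral>x. norm (f x) \<partial>lborel)"
  unfolding fourier_eq_lborel[OF assms]
  using integral_norm_bound[of lborel "\<lambda>x. f x * cis (- (k \<bullet> x))"] by (simp add: norm_mult)

section \<open>Transforms of derivatives and stability of the Schwartz space\<close>

lemma lborel_integral_translate:
  fixes f :: "'a::euclidean_space \<Rightarrow> 'b::{banach, second_countable_topology}"
  assumes [measurable]: "f \<in> borel_measurable borel"
  shows "(\<integral>x. f (x + a) \<partial>lborel) = (\<integral>x. f x \<partial>lborel)"
proof -
  have "(\<integral>x. f x \<partial>lborel) = (\<integral>x. f x \<partial>distr lborel borel ((+) a))"
    by (simp add: lborel_distr_plus)
  also have "\<dots> = (\<integral>x. f (a + x) \<partial>lborel)"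
    by (rule integral_distr) measurable
  finally show ?thesis by (simp add: add.commute)
qed

lemma fourier_translate:
  assumes [measurable]: "f \<in> borel_measurable borel"
  shows "fourier (\<lambda>x. f (x + a)) k = cis (k \<bullet> a) * fourier f k"
proof -
  have "fourier (\<lambda>x. f (x + a)) k = (\<integral>x. f (x + a) * cis (- (k \<bullet> x)) \<partial>lborel)"
    by (rule fourier_eq_lborel) measurable
  also have "\<dots> = (\<integral>x. cis (k \<bullet> a) * (f (x + a) * cis (- (k \<bullet> (x + a)))) \<partial>lborel)"
    by (intro Bochner_Integration.integral_cong refl)
       (simp add: mult_ac cis_mult inner_add_right)
  also have "\<dots> = cis (k \<bullet> a) * (\<integral>x. f (x + a) * cis (- (k \<bullet> (x + a))) \<partial>lborel)"
    by simp
  also have "(\<integral>x. f (x + a) * cis (- (k \<bullet> (x + a))) \<partial>lborel) = fourier f k"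
    by (subst lborel_integral_translate[where f = "\<lambda>x. f x * cis (- (k \<bullet> x))"])
       (simp_all add: fourier_eq_lborel)
  finally show ?thesis .
qed

text \<open>Supplies a dominating function, uniform in \<open>t\<close>, for the limit of difference
  quotients under the integral. It comes from the mean value theorem along the segment and the decay
  of the partial derivative.\<close>

lemma schwartz_difference_quotient_bound:
  fixes f :: "real^'n::finite \<Rightarrow> complex"
  assumes f: "f \<in> schwartz"
  obtains C where "C > 0"
    "\<And>x t. 0 < t \<Longrightarrow> t \<le> 1 \<Longrightarrow> norm (f (x + t *\<^sub>R axis j 1) - f x) \<le> t * (C / (1 + norm x) ^ N)"
proof -
  have "rapidly_decreasing (partial_deriv j f)"
    by (intro schwartz_rapidly_decreasing schwartz_partial_deriv f)
  then obtain C where C: "C > 0" "\<And>x. norm (partial_deriv j f x) \<le> C / (1 + norm x) ^ N"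
    using rapidly_decreasing_bound by blast
  show ?thesis
  \<comment> \<open>The mean value theorem gives decay at an intermediate point at distance less
    than 1 from \<open>x\<close>. There \<open>1 + norm x\<close> is at most twice the corresponding
    weight, which costs the factor \<open>2 ^ N\<close>.\<close>
  proof (rule that[of "C * 2 ^ N"])
    show "C * 2 ^ N > 0" using C by simp
    fix x :: "real^'n" and t :: real
    assume t: "0 < t" "t \<le> 1"
    let ?e = "axis j 1 :: real^'n"
    let ?p = "\<lambda>s. f (x + s *\<^sub>R ?e)"
    have der: "(?p has_derivative (\<lambda>h. h *\<^sub>R partial_deriv j f (x + s *\<^sub>R ?e))) (at s)" for s
    proof -
      have *: "(?p has_derivative (\<lambda>h. frechet_derivative f (at (x + s *\<^sub>R ?e)) (h *\<^sub>R ?e))) (at s)"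
        by (rule has_derivative_compose[where f = "\<lambda>s. x + s *\<^sub>R ?e" and g = f])
           (auto intro!: derivative_eq_intros differentiable_imp_has_derivative schwartz_differentiable f)
      have "frechet_derivative f (at y) (h *\<^sub>R ?e) = h *\<^sub>R partial_deriv j f y" for h y
        using linear_frechet_derivative[OF schwartz_differentiable[OF f]]
        by (simp add: partial_deriv_def linear_scale)
      with * show ?thesis by simp
    qed
    have "continuous_on {0..t} ?p"
      using has_derivative_continuous[OF der] by (simp add: continuous_at_imp_continuous_on)
    from mvt_general[OF t(1) this der]
    obtain s where s: "s \<in> {0<..<t}" "norm (?p t - ?p 0) \<le> norm ((t - 0) *\<^sub>R partial_deriv j f (x + s *\<^sub>R ?e))"
      by blast
    have "norm x \<le> norm (x + s *\<^sub>R ?e) + norm (s *\<^sub>R ?e)"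
      using norm_triangle_ineq4[of "x + s *\<^sub>R ?e" "s *\<^sub>R ?e"] by simp
    then have "1 + norm x \<le> 2 * (1 + norm (x + s *\<^sub>R ?e))"
      using s t norm_ge_zero[of "x + s *\<^sub>R ?e"] by (simp del: norm_ge_zero)
    then have "(1 + norm x) ^ N \<le> (2 * (1 + norm (x + s *\<^sub>R ?e))) ^ N"
      by (intro power_mono) auto
    then have pw: "(1 + norm x) ^ N \<le> 2 ^ N * (1 + norm (x + s *\<^sub>R ?e)) ^ N"
      by (simp only: power_mult_distrib)
    have pos: "0 < (1 + norm y) ^ N" for y :: "real^'n"
      by (intro zero_less_power) (simp add: add_pos_nonneg)
    have "C / (1 + norm (x + s *\<^sub>R ?e)) ^ N \<le> C * 2 ^ N / (1 + norm x) ^ N"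
      using mult_left_mono[OF pw, of C] C(1) pos[of x] pos[of "x + s *\<^sub>R ?e"]
      by (simp add: field_simps)
    then have "norm (partial_deriv j f (x + s *\<^sub>R ?e)) \<le> C * 2 ^ N / (1 + norm x) ^ N"
      using C(2) order.trans by blast
    from mult_left_mono[OF this, of t] s(2) t
    show "norm (f (x + t *\<^sub>R ?e) - f x) \<le> t * (C * 2 ^ N / (1 + norm x) ^ N)"
      by simp
  qed
qed

text \<open>Translation replaces integration by parts: the transform of a difference quotient is
  that of \<open>f\<close> times the difference quotient of \<open>cis (s * k $ j)\<close> at 0.
  Both sides are computed in the limit and compared.\<close>

lemma fourier_partial_deriv:
  fixes f :: "real^'n::finite \<Rightarrow> complex"
  assumes f: "f \<in> schwartz"
  shows "fourier (partial_deriv j f) k = \<i> * complex_of_real (k $ j) * fourier f k"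
proof -
  let ?e = "axis j 1 :: real^'n"
  \<comment> \<open>A sequence, because dominated convergence is sequential; its values are nonzero
    and at most 1, as the dominating bound requires.\<close>
  define t where "t m = inverse (real (Suc m))" for m
  have t: "0 < t m" "t m \<le> 1" for m
    by (auto simp: t_def inverse_le_1_iff)
  have t0: "t \<longlonglongrightarrow> 0" unfolding t_def by (rule LIMSEQ_inverse_real_of_nat)
  have t0': "filterlim t (at 0) sequentially"
    using t by (intro filterlim_atI t0 always_eventually) (auto simp: less_imp_neq[symmetric])
  have rf: "rapidly_decreasing f" by (rule schwartz_rapidly_decreasing[OF f])
  then have [measurable]: "f \<in> borel_measurable borel" by measurable
  have [measurable]: "partial_deriv j f \<in> borel_measurable borel"
    using schwartz_rapidly_decreasing[OF schwartz_partial_deriv[OF f]] by measurable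
  obtain C where C: "C > 0"
    "\<And>x t. 0 < t \<Longrightarrow> t \<le> 1 \<Longrightarrow> norm (f (x + t *\<^sub>R ?e) - f x) \<le> t * (C / (1 + norm x) ^ (2 * DIM(real^'n)))"
    using schwartz_difference_quotient_bound[OF f] by blast
  let ?q = "\<lambda>m x. inverse (t m) *\<^sub>R (f (x + t m *\<^sub>R ?e) - f x) * cis (- (k \<bullet> x))"
  have "(\<lambda>m. \<integral>x. ?q m x \<partial>lborel) \<longlonglongrightarrow> (\<integral>x. partial_deriv j f x * cis (- (k \<bullet> x)) \<partial>lborel)"
  proof (rule integral_dominated_convergence)
    show "integrable lborel (\<lambda>x::real^'n. C * (1 / (1 + norm x) ^ (2 * DIM(real^'n))))"
      by (intro integrable_mult_right integrable_inverse_power_norm)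
    show "AE x in lborel. norm (?q m x) \<le> C * (1 / (1 + norm x) ^ (2 * DIM(real^'n)))" for m
    proof (rule AE_I2)
      fix x
      have "norm (?q m x) = norm (f (x + t m *\<^sub>R ?e) - f x) / t m"
        using t[of m] by (simp add: norm_mult divide_inverse mult.commute)
      also have "\<dots> \<le> C * (1 / (1 + norm x) ^ (2 * DIM(real^'n)))"
        using C(2)[OF t[of m], of x] t[of m] by (simp add: divide_le_eq mult_ac)
      finally show "norm (?q m x) \<le> C * (1 / (1 + norm x) ^ (2 * DIM(real^'n)))" .
    qed
    show "AE x in lborel. (\<lambda>m. ?q m x) \<longlonglongrightarrow> partial_deriv j f x * cis (- (k \<bullet> x))"
    proof (rule AE_I2)
      fix x
      have "((\<lambda>s. x + s *\<^sub>R ?e) has_derivative (\<lambda>s. s *\<^sub>R ?e)) (at 0)"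
        by (auto intro!: derivative_eq_intros)
      then have "((\<lambda>s. f (x + s *\<^sub>R ?e)) has_derivative (\<lambda>s. frechet_derivative f (at x) (s *\<^sub>R ?e))) (at 0)"
        by (rule has_derivative_compose) (auto intro!: differentiable_imp_has_derivative schwartz_differentiable f)
      then have "((\<lambda>s. f (x + s *\<^sub>R ?e)) has_vector_derivative partial_deriv j f x) (at 0)"
        using linear_frechet_derivative[OF schwartz_differentiable[OF f]]
        by (simp add: has_vector_derivative_def partial_deriv_def linear_scale)
      from filterlim_compose[OF has_vector_derivative_imp_difference_quotient[OF this] t0']
      have "(\<lambda>m. inverse (t m) *\<^sub>R (f (x + t m *\<^sub>R ?e) - f x)) \<longlonglongrightarrow> partial_deriv j f x"
        by simp
      then show "(\<lambda>m. ?q m x) \<longlonglongrightarrow> partial_deriv j f x * cis (- (k \<bullet> x))"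
        by (rule tendsto_mult_right)
    qed
  qed measurable
  \<comment> \<open>\<open>cis (0 * k $ j)\<close> is 1, kept in this form so that the bracket is
    visibly an increment of \<open>\<lambda>s. cis (s * k $ j)\<close> from 0.\<close>
  also have "(\<lambda>m. \<integral>x. ?q m x \<partial>lborel) = (\<lambda>m. inverse (t m) *\<^sub>R (cis (t m * k $ j) - cis (0 * k $ j)) * fourier f k)"
  proof
    fix m
    have i1: "integrable lborel (\<lambda>x. f x * cis (- (k \<bullet> x)))"
      by (intro integrable_mult_cis rapidly_decreasing_integrable rf) measurable
    have i2: "integrable lborel (\<lambda>x. f (x + t m *\<^sub>R ?e) * cis (- (k \<bullet> x)))"
    proof (intro integrable_mult_cis)
      have "integrable (distr lborel borel ((+) (t m *\<^sub>R ?e))) f"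
        by (simp add: lborel_distr_plus rapidly_decreasing_integrable rf)
      then show "integrable lborel (\<lambda>x. f (x + t m *\<^sub>R ?e))"
        by (subst (asm) integrable_distr_eq) (auto simp: add.commute)
    qed measurable
    have "(\<integral>x. ?q m x \<partial>lborel) = (\<integral>x. inverse (t m) *\<^sub>R (f (x + t m *\<^sub>R ?e) * cis (- (k \<bullet> x)) - f x * cis (- (k \<bullet> x))) \<partial>lborel)"
      by (intro Bochner_Integration.integral_cong) (auto simp: algebra_simps)
    also have "\<dots> = inverse (t m) *\<^sub>R (fourier (\<lambda>x. f (x + t m *\<^sub>R ?e)) k - fourier f k)"
      using i1 i2 by (simp add: fourier_eq_lborel)
    also have "\<dots> = inverse (t m) *\<^sub>R (cis (t m * k $ j) - cis (0 * k $ j)) * fourier f k"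
      by (subst fourier_translate) (simp_all add: inner_axis algebra_simps)
    finally show "(\<integral>x. ?q m x \<partial>lborel) = inverse (t m) *\<^sub>R (cis (t m * k $ j) - cis (0 * k $ j)) * fourier f k" .
  qed
  finally have lim: "(\<lambda>m. inverse (t m) *\<^sub>R (cis (t m * k $ j) - cis (0 * k $ j)) * fourier f k) \<longlonglongrightarrow> fourier (partial_deriv j f) k"
    by (simp only: fourier_eq_lborel \<open>partial_deriv j f \<in> borel_measurable borel\<close>)
  have "(\<lambda>m. inverse (t m) *\<^sub>R (cis (t m * k $ j) - cis (0 * k $ j)) * fourier f k)
     \<longlonglongrightarrow> (\<i> * complex_of_real (k $ j)) * fourier f k"
  proof (rule tendsto_mult_right)
    have "((\<lambda>s. cis (s * k $ j)) has_vector_derivative \<i> * complex_of_real (k $ j)) (at 0)"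
    proof -
      have "((\<lambda>s. \<i> * complex_of_real (s * k $ j)) has_vector_derivative \<i> * complex_of_real (k $ j)) (at 0)"
        by (auto intro!: derivative_eq_intros)
      from field_vector_diff_chain_at[OF this, of exp 1]
      show ?thesis by (simp add: o_def cis_conv_exp DERIV_exp[of 0, simplified])
    qed
    from filterlim_compose[OF has_vector_derivative_imp_difference_quotient[OF this] t0']
    show "(\<lambda>m. inverse (t m) *\<^sub>R (cis (t m * k $ j) - cis (0 * k $ j))) \<longlonglongrightarrow> \<i> * complex_of_real (k $ j)"
      by simp
  qed
  with lim show ?thesis
    by (rule LIMSEQ_unique)
qed

text \<open>One further power of the weight is bounded by 1 plus the sum of the |k_j|, and each
  |k_j| turns the transform of \<open>f\<close> into that of a partial derivative. Hence the
  induction on \<open>N\<close> is over all Schwartz functions at once.\<close>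

lemma rapidly_decreasing_fourier:
  fixes f :: "real^'n::finite \<Rightarrow> complex"
  assumes f: "f \<in> schwartz"
  shows "rapidly_decreasing (fourier f)"
proof (rule rapidly_decreasingI)
  have rf: "rapidly_decreasing f" by (rule schwartz_rapidly_decreasing[OF f])
  show "continuous_on UNIV (fourier f)"
    using has_derivative_continuous[OF fourier_has_derivative[OF rf]]
    by (simp add: continuous_at_imp_continuous_on)
  fix N :: nat
  show "\<exists>C. \<forall>k. (1 + norm k) ^ N * norm (fourier f k) \<le> C"
    using f
  proof (induction N arbitrary: f)
    case 0
    have "f \<in> borel_measurable borel" using schwartz_rapidly_decreasing[OF 0] by measurable
    then show ?case using norm_fourier_le by auto
  next
    case (Suc N)
    obtain C where C: "\<And>k. (1 + norm k) ^ N * norm (fourier f k) \<le> C"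
      using Suc.IH[OF Suc.prems] by blast
    have "\<forall>j. \<exists>D. \<forall>k. (1 + norm k) ^ N * norm (fourier (partial_deriv j f) k) \<le> D"
      using Suc.IH[OF schwartz_partial_deriv[OF Suc.prems]] by blast
    then obtain D where D: "\<And>j k. (1 + norm k) ^ N * norm (fourier (partial_deriv j f) k) \<le> D j"
      by metis
    have "(1 + norm k) ^ Suc N * norm (fourier f k) \<le> C + (\<Sum>j\<in>UNIV. D j)" for k
    proof -
      have "(1 + norm k) ^ Suc N * norm (fourier f k) = (1 + norm k) * ((1 + norm k) ^ N * norm (fourier f k))"
        by simp
      also have "\<dots> \<le> (1 + (\<Sum>j\<in>UNIV. \<bar>k $ j\<bar>)) * ((1 + norm k) ^ N * norm (fourier f k))"
        using norm_le_l1_cart[of k] by (intro mult_right_mono) auto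
      also have "\<dots> = (1 + norm k) ^ N * norm (fourier f k)
          + (\<Sum>j\<in>UNIV. (1 + norm k) ^ N * norm (fourier (partial_deriv j f) k))"
        by (simp add: fourier_partial_deriv[OF Suc.prems] norm_mult distrib_left sum_distrib_left mult_ac)
      also have "\<dots> \<le> C + (\<Sum>j\<in>UNIV. D j)"
        by (intro add_mono sum_mono C D)
      finally show ?thesis .
    qed
    then show ?case by blast
  qed
qed

text \<open>The image of the Schwartz space is closed under partial derivatives, since these
  correspond to multiplying the original function by -i x_j.\<close>

lemma schwartz_fourier:
  assumes "f \<in> schwartz"
  shows "fourier f \<in> schwartz"
proof (rule schwartz_coinduct[where X = "fourier ` schwartz"])
  fix h :: "real^'a \<Rightarrow> complex" assume "h \<in> fourier ` schwartz"
  then obtain f where h: "h = fourier f" and f: "f \<in> schwartz" by blast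
  have rf: "rapidly_decreasing f" by (rule schwartz_rapidly_decreasing[OF f])
  show "rapidly_decreasing h" unfolding h by (rule rapidly_decreasing_fourier[OF f])
  show "h differentiable (at x)" for x
    unfolding h differentiable_def using fourier_has_derivative[OF rf] by blast
  show "partial_deriv i h \<in> fourier ` schwartz" for i
    unfolding h partial_deriv_fourier[OF rf]
    by (intro imageI schwartz_cmult schwartz_mult_coord f)
qed (use assms in blast)

text \<open>Both sides are iterated integrals of f(x) g(k) \<open>cis (- (k \<bullet> x))\<close>.
  The exponential has modulus 1, so the integrability of \<open>f\<close> and \<open>g\<close> is
  all that Fubini asks for.\<close>

lemma integral_fourier_mult:
  assumes fi: "integrable lborel f" and gi: "integrable lborel g"
  shows "(\<integral>k. fourier f k * g k \<partial>lborel) = (\<integral>x. f x * fourier g x \<partial>lborel)"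
proof -
  have [measurable]: "f \<in> borel_measurable borel" "g \<in> borel_measurable borel"
    using borel_measurable_integrable[OF fi] borel_measurable_integrable[OF gi] by simp_all
  let ?h = "\<lambda>k x. g k * (f x * cis (- (k \<bullet> x)))"
  have int: "integrable (lborel \<Otimes>\<^sub>M lborel) (\<lambda>(k, x). ?h k x)"
  proof (rule lborel_pair.Fubini_integrable)
    show "(\<lambda>(k, x). ?h k x) \<in> borel_measurable (lborel \<Otimes>\<^sub>M lborel)" by measurable
    show "integrable lborel (\<lambda>k. \<integral>x. norm (case (k, x) of (k, x) \<Rightarrow> ?h k x) \<partial>lborel)"
      using gi by (simp add: norm_mult)
    show "AE k in lborel. integrable lborel (\<lambda>x. case (k, x) of (k, x) \<Rightarrow> ?h k x)"
      by (rule AE_I2) (auto intro!: integrable_mult_right integrable_mult_cis fi)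
  qed
  have "(\<integral>k. fourier f k * g k \<partial>lborel) = (\<integral>k. \<integral>x. ?h k x \<partial>lborel \<partial>lborel)"
    by (simp add: fourier_eq_lborel mult.commute)
  also have "\<dots> = (\<integral>x. \<integral>k. ?h k x \<partial>lborel \<partial>lborel)"
    by (rule lborel_pair.Fubini_integral[OF int, symmetric])
  also have "\<dots> = (\<integral>x. f x * fourier g x \<partial>lborel)"
  proof (intro Bochner_Integration.integral_cong refl)
    fix x
    have "(\<integral>k. ?h k x \<partial>lborel) = (\<integral>k. f x * (g k * cis (- (x \<bullet> k))) \<partial>lborel)"
      by (simp add: mult_ac inner_commute)
    then show "(\<integral>k. ?h k x \<partial>lborel) = f x * fourier g x"
      by (simp add: fourier_eq_lborel)
  qed
  finally show ?thesis .
qed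

section \<open>Gaussians and Fourier inversion\<close>

text \<open>The parameter is an inverse width, so the transform exchanges \<open>r\<close> and
  \<open>1 / r\<close>.\<close>

definition gaussian :: "real \<Rightarrow> real^'n::finite \<Rightarrow> complex" where
  "gaussian r x = complex_of_real (exp (- (r\<^sup>2 * (norm x)\<^sup>2 / 2)))"

lemma borel_measurable_gaussian [measurable]: "gaussian r \<in> borel_measurable borel"
  unfolding gaussian_def by measurable

lemma norm_gaussian: "norm (gaussian r x) = exp (- (r\<^sup>2 * (norm x)\<^sup>2 / 2))"
  by (simp add: gaussian_def)

lemma rapidly_decreasing_gaussian:
  assumes "r > 0"
  shows "rapidly_decreasing (gaussian r)"
proof (rule rapidly_decreasingI)
  show "continuous_on UNIV (gaussian r :: real^'a \<Rightarrow> complex)"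
    unfolding gaussian_def by (intro continuous_intros) auto
  fix N :: nat
  \<comment> \<open>The exponent on the right is the maximum of N s - r^2 s^2 / 2 over s, found by
    completing the square.\<close>
  have "(1 + norm x) ^ N * norm (gaussian r x) \<le> exp ((real N)\<^sup>2 / (2 * r\<^sup>2))" for x :: "real^'a"
  proof -
    have "(1 + norm x) ^ N \<le> exp (norm x) ^ N"
      by (intro power_mono) auto
    then have "(1 + norm x) ^ N * norm (gaussian r x) \<le> exp (norm x) ^ N * exp (- (r\<^sup>2 * (norm x)\<^sup>2 / 2))"
      unfolding norm_gaussian by (intro mult_right_mono) auto
    also have "\<dots> = exp (real N * norm x - r\<^sup>2 * (norm x)\<^sup>2 / 2)"
      by (simp add: exp_of_nat_mult[symmetric] exp_add[symmetric])
    also have "\<dots> \<le> exp ((real N)\<^sup>2 / (2 * r\<^sup>2))"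
    proof -
      have "0 \<le> (r * norm x - real N / r)\<^sup>2" by simp
      also have "\<dots> = 2 * ((real N)\<^sup>2 / (2 * r\<^sup>2) - (real N * norm x - r\<^sup>2 * (norm x)\<^sup>2 / 2))"
        using assms by (simp add: power2_eq_square field_simps)
      finally show ?thesis by simp
    qed
    finally show ?thesis .
  qed
  then show "\<exists>C. \<forall>x::real^'a. (1 + norm x) ^ N * norm (gaussian r x) \<le> C" by blast
qed

text \<open>A rescaling of the characteristic function of the standard normal distribution.\<close>

lemma gaussian_real_fourier:
  assumes r: "r > 0"
  shows "integrable lborel (\<lambda>x. complex_of_real (exp (- (r\<^sup>2 * x\<^sup>2 / 2))) * cis (- (\<kappa> * x)))"
    and "(\<integral>x. complex_of_real (exp (- (r\<^sup>2 * x\<^sup>2 / 2))) * cis (- (\<kappa> * x)) \<partial>lborel)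
       = complex_of_real (sqrt (2 * pi) / r * exp (- ((1 / r)\<^sup>2 * \<kappa>\<^sup>2 / 2)))"
proof -
  \<comment> \<open>Replacing \<open>x\<close> by \<open>r * x\<close> will turn the frequency
    \<kappa> / r into \<kappa>; the minus sign matches the convention of
    \<open>fourier\<close>.\<close>
  let ?F = "\<lambda>x. std_normal_density x *\<^sub>R cis (- (\<kappa> / r) * x)"
  have F: "?F (0 + r * x) = complex_of_real (1 / sqrt (2 * pi)) * (complex_of_real (exp (- (r\<^sup>2 * x\<^sup>2 / 2))) * cis (- (\<kappa> * x)))" for x
    using r by (simp add: std_normal_density_def scaleR_conv_of_real power_mult_distrib mult_ac)
  have "integrable lborel (\<lambda>x. complex_of_real (std_normal_density x) * cis (- (\<kappa> / r) * x))"
    by (intro integrable_mult_cis integrable_of_real) auto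
  then have "integrable lborel ?F" by (simp add: scaleR_conv_of_real)
  from lborel_integrable_real_affine[OF this, of r 0] r
  have "integrable lborel (\<lambda>x. complex_of_real (1 / sqrt (2 * pi)) * (complex_of_real (exp (- (r\<^sup>2 * x\<^sup>2 / 2))) * cis (- (\<kappa> * x))))"
    unfolding F by simp
  from integrable_mult_right[OF this, of "complex_of_real (sqrt (2 * pi))"]
  show "integrable lborel (\<lambda>x. complex_of_real (exp (- (r\<^sup>2 * x\<^sup>2 / 2))) * cis (- (\<kappa> * x)))"
    by (simp only: mult.assoc[symmetric] of_real_mult[symmetric]) simp
  have "complex_of_real (exp (- (- (\<kappa> / r))\<^sup>2 / 2)) = (\<integral>x. ?F x \<partial>lborel)"
    unfolding fun_cong[OF char_std_normal_distribution, of "- (\<kappa> / r)", symmetric] char_def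
    by (subst integral_density) (auto simp: cis_conv_exp)
  also have "\<dots> = \<bar>r\<bar> *\<^sub>R (\<integral>x. ?F (0 + r * x) \<partial>lborel)"
    using r by (intro lborel_integral_real_affine) auto
  also have "\<dots> = complex_of_real (r / sqrt (2 * pi)) * (\<integral>x. complex_of_real (exp (- (r\<^sup>2 * x\<^sup>2 / 2))) * cis (- (\<kappa> * x)) \<partial>lborel)"
    unfolding F using r by (simp add: scaleR_conv_of_real)
  finally show "(\<integral>x. complex_of_real (exp (- (r\<^sup>2 * x\<^sup>2 / 2))) * cis (- (\<kappa> * x)) \<partial>lborel)
       = complex_of_real (sqrt (2 * pi) / r * exp (- ((1 / r)\<^sup>2 * \<kappa>\<^sup>2 / 2)))"
    using r by (simp add: field_simps power_divide)
qed

lemma cis_sum: "finite A \<Longrightarrow> cis (sum f A) = (\<Prod>a\<in>A. cis (f a))"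
  by (induction A rule: finite_induct) (simp_all add: cis_mult[symmetric])

text \<open>Both the Gaussian and the exponential factor over the coordinates, so the
  one-dimensional transform occurs once per coordinate.\<close>

lemma fourier_gaussian:
  fixes k :: "real^'n::finite"
  assumes r: "r > 0"
  shows "fourier (gaussian r) k = complex_of_real ((sqrt (2 * pi) / r) ^ CARD('n)) * gaussian (1 / r) k"
proof -
  have gauss_prod: "gaussian s x = (\<Prod>b\<in>Basis. complex_of_real (exp (- (s\<^sup>2 * (x \<bullet> b)\<^sup>2 / 2))))" for s and x :: "real^'n"
  proof -
    have "s\<^sup>2 * (norm x)\<^sup>2 / 2 = (\<Sum>b\<in>Basis. s\<^sup>2 * (x \<bullet> b)\<^sup>2 / 2)"
    proof -
      have "(norm x)\<^sup>2 = (\<Sum>b\<in>Basis. (x \<bullet> b)\<^sup>2)"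
        unfolding power2_norm_eq_inner unfolding power2_eq_square by (rule euclidean_inner)
      then show ?thesis by (simp add: sum_distrib_left sum_divide_distrib)
    qed
    then show ?thesis
      by (simp add: gaussian_def exp_sum sum_negf[symmetric])
  qed
  have "fourier (gaussian r) k = (\<integral>x. gaussian r x * cis (- (k \<bullet> x)) \<partial>lborel)"
    by (rule fourier_eq_lborel) measurable
  also have "\<dots> = (\<integral>x. (\<Prod>b\<in>Basis. complex_of_real (exp (- (r\<^sup>2 * (x \<bullet> b)\<^sup>2 / 2))) * cis (- ((k \<bullet> b) * (x \<bullet> b)))) \<partial>lborel)"
  proof (intro Bochner_Integration.integral_cong refl)
    fix x :: "real^'n"
    have "cis (- (k \<bullet> x)) = (\<Prod>b\<in>Basis. cis (- ((k \<bullet> b) * (x \<bullet> b))))"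
      by (simp add: euclidean_inner[of k x] sum_negf[symmetric] cis_sum)
    then show "gaussian r x * cis (- (k \<bullet> x)) = (\<Prod>b\<in>Basis. complex_of_real (exp (- (r\<^sup>2 * (x \<bullet> b)\<^sup>2 / 2))) * cis (- ((k \<bullet> b) * (x \<bullet> b))))"
      by (simp only: gauss_prod prod.distrib)
  qed
  also have "\<dots> = (\<Prod>b\<in>(Basis::(real^'n) set). complex_of_real (sqrt (2 * pi) / r * exp (- ((1 / r)\<^sup>2 * (k \<bullet> b)\<^sup>2 / 2))))"
    by (subst integrable_prod_Basis(2)[where f = "\<lambda>b t. complex_of_real (exp (- (r\<^sup>2 * t\<^sup>2 / 2))) * cis (- ((k \<bullet> b) * t))"])
       (simp_all only: gaussian_real_fourier[OF r])
  also have "\<dots> = complex_of_real ((sqrt (2 * pi) / r) ^ CARD('n)) * gaussian (1 / r) k"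
    unfolding gauss_prod of_real_mult prod.distrib by simp
  finally show ?thesis .
qed

lemma fourier_cmult:
  assumes [measurable]: "f \<in> borel_measurable borel"
  shows "fourier (\<lambda>x. c * f x) k = c * fourier f k"
proof -
  have "(\<lambda>x. c * f x) \<in> borel_measurable borel" by measurable
  then show ?thesis by (simp add: fourier_eq_lborel mult.assoc)
qed

lemma gaussian_has_derivative:
  fixes x :: "real^'n::finite"
  shows "(gaussian s has_derivative (\<lambda>h. complex_of_real (- s\<^sup>2 * (x \<bullet> h)) * gaussian s x)) (at x)"
proof -
  have "((\<lambda>x::real^'n. exp (- (s\<^sup>2 * (x \<bullet> x) / 2))) has_derivative
      (\<lambda>h. exp (- (s\<^sup>2 * (x \<bullet> x) / 2)) * (- s\<^sup>2 * (x \<bullet> h)))) (at x)"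
    by (auto intro!: derivative_eq_intros simp: inner_commute)
  from has_derivative_of_real[OF this]
  show ?thesis
    by (simp add: gaussian_def[abs_def] power2_norm_eq_inner mult.commute)
qed

text \<open>Each factor x_j under the transform amounts to i times a derivative in k_j, so the left
  side is minus the mixed second derivative of the transformed Gaussian. The term with 1 / r^2
  arises when the second derivative hits the factor k_j produced by the first.\<close>

lemma fourier_second_moment_gaussian:
  fixes k :: "real^'n::finite"
  assumes r: "r > 0"
  shows "fourier (\<lambda>x. complex_of_real (x $ i * x $ j) * gaussian r x) k =
    complex_of_real ((sqrt (2 * pi) / r) ^ CARD('n) * ((if i = j then 1 else 0) / r\<^sup>2 - k $ i * k $ j / r ^ 4))
      * gaussian (1 / r) k"
proof -
  let ?g = "gaussian r :: real^'n \<Rightarrow> complex" and ?G = "gaussian (1 / r) :: real^'n \<Rightarrow> complex"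
  let ?c = "complex_of_real ((sqrt (2 * pi) / r) ^ CARD('n))"
  have g: "rapidly_decreasing ?g" by (rule rapidly_decreasing_gaussian[OF r])
  let ?g1 = "\<lambda>x. - \<i> * (complex_of_real (x $ j) * ?g x)"
  have g1: "rapidly_decreasing ?g1"
    by (intro rapidly_decreasing_cmult rapidly_decreasing_mult_coord g)
  \<comment> \<open>Written as a coordinate times a function, the shape to which
    \<open>has_derivative_mult_coord\<close> applies for the second derivative.\<close>
  have F1: "fourier ?g1 = (\<lambda>k. complex_of_real (k $ j) * (- (?c / complex_of_real (r\<^sup>2)) * ?G k))"
  proof
    fix k
    have "(fourier ?g has_derivative (\<lambda>h. ?c * (complex_of_real (- (1 / r)\<^sup>2 * (k \<bullet> h)) * ?G k))) (at k)"
      unfolding fourier_gaussian[OF r, abs_def]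
      by (rule has_derivative_mult_right[OF gaussian_has_derivative])
    then have "partial_deriv j (fourier ?g) k = ?c * (complex_of_real (- (1 / r)\<^sup>2 * (k \<bullet> axis j 1)) * ?G k)"
      by (rule partial_deriv_eqI)
    then show "fourier ?g1 k = complex_of_real (k $ j) * (- (?c / complex_of_real (r\<^sup>2)) * ?G k)"
      by (simp add: partial_deriv_fourier[OF g] inner_axis power_divide)
  qed
  have dG: "((\<lambda>k. - (?c / complex_of_real (r\<^sup>2)) * ?G k) has_derivative
      (\<lambda>h. - (?c / complex_of_real (r\<^sup>2)) * (complex_of_real (- (1 / r)\<^sup>2 * (k \<bullet> h)) * ?G k))) (at k)"
    by (rule has_derivative_mult_right[OF gaussian_has_derivative])
  have "partial_deriv i (fourier ?g1) k =
     complex_of_real (k $ j) * (- (?c / complex_of_real (r\<^sup>2)) * (complex_of_real (- (1 / r)\<^sup>2 * (k \<bullet> axis i 1)) * ?G k))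
     + complex_of_real (axis i 1 $ j) * (- (?c / complex_of_real (r\<^sup>2)) * ?G k)"
    unfolding F1
    by (subst partial_deriv_eqI[OF has_derivative_mult_coord])
       (use dG in \<open>auto simp only: differentiable_def frechet_derivative_at[OF dG, symmetric]\<close>)
  also have "\<dots> = - (complex_of_real ((sqrt (2 * pi) / r) ^ CARD('n) * ((if i = j then 1 else 0) / r\<^sup>2 - k $ i * k $ j / r ^ 4))
      * ?G k)"
  proof -
    have "k \<bullet> axis i 1 = k $ i" "axis i (1::real) $ j = (if i = j then 1 else 0)"
      by (simp_all add: inner_axis) (simp add: axis_def)
    then show ?thesis
      using r by (simp add: field_simps power2_eq_square power4_eq_xxxx)
  qed
  finally have "partial_deriv i (fourier ?g1) k = \<dots>" .
  moreover have "partial_deriv i (fourier ?g1) k = - fourier (\<lambda>x. complex_of_real (x $ i * x $ j) * ?g x) k"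
  proof -
    have m: "(\<lambda>x. complex_of_real (x $ i) * (complex_of_real (x $ j) * ?g x)) \<in> borel_measurable borel"
      using rapidly_decreasing_mult_coord[OF rapidly_decreasing_mult_coord[OF g]] by measurable
    have "(\<lambda>x. - \<i> * (complex_of_real (x $ i) * ?g1 x)) = (\<lambda>x. (-1) * (complex_of_real (x $ i) * (complex_of_real (x $ j) * ?g x)))"
      by (simp add: fun_eq_iff algebra_simps)
    then show ?thesis
      by (simp only: partial_deriv_fourier[OF g1] fourier_cmult[OF m]) (simp add: mult_ac)
  qed
  ultimately show ?thesis by simp
qed

section \<open>Fourier inversion\<close>

lemma lborel_integral_scale:
  fixes f :: "'a::euclidean_space \<Rightarrow> 'b::{banach, second_countable_topology}"
  assumes [measurable]: "f \<in> borel_measurable borel" and c: "c > 0"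
  shows "(\<integral>x. f x \<partial>lborel) = c ^ DIM('a) *\<^sub>R (\<integral>x. f (c *\<^sub>R x) \<partial>lborel)"
proof -
  have "(\<integral>x. f x \<partial>lborel) = (\<integral>x. f x \<partial>density (distr lborel borel (\<lambda>x::'a. 0 + c *\<^sub>R x)) (\<lambda>_. \<bar>c\<bar> ^ DIM('a)))"
    using c by (subst lborel_affine[of c 0]) auto
  also have "\<dots> = c ^ DIM('a) *\<^sub>R (\<integral>x. f (c *\<^sub>R x) \<partial>lborel)"
    using c by (subst integral_density) (auto simp: integral_distr)
  finally show ?thesis .
qed

text \<open>Inversion at the origin by Gaussian summation: a wide Gaussian is inserted as a
  convergence factor, the multiplication formula turns it into a concentrating one, and only
  \<open>f 0\<close> survives in the limit. Of the factor (2 pi)^n, one square root comes from the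
  transform of the Gaussian and the other from its mass.\<close>

lemma integral_fourier:
  fixes f :: "real^'n::finite \<Rightarrow> complex"
  assumes int: "integrable lborel f" and cont: "continuous_on UNIV f"
    and bound: "\<And>x. norm (f x) \<le> B"
    and intF: "integrable lborel (fourier f)"
  shows "(\<integral>k. fourier f k \<partial>lborel) = complex_of_real ((2 * pi) ^ CARD('n)) * f 0"
proof -
  have [measurable]: "f \<in> borel_measurable borel" by (rule borel_measurable_continuous_onI[OF cont])
  have [measurable]: "fourier f \<in> borel_measurable borel"
    using borel_measurable_integrable[OF intF] by simp
  have gi: "integrable lborel (gaussian s :: real^'n \<Rightarrow> complex)" if "s > 0" for s
    using that by (intro rapidly_decreasing_integrable rapidly_decreasing_gaussian)
  define t where "t m = inverse (real (Suc m))" for m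
  have t: "0 < t m" for m by (simp add: t_def)
  have t0: "t \<longlonglongrightarrow> 0" unfolding t_def by (rule LIMSEQ_inverse_real_of_nat)
  let ?c = "complex_of_real (sqrt (2 * pi) ^ CARD('n))"
  have 1: "(\<lambda>m. \<integral>k. fourier f k * gaussian (t m) k \<partial>lborel) \<longlonglongrightarrow> (\<integral>k. fourier f k \<partial>lborel)"
  proof (rule integral_dominated_convergence)
    show "integrable lborel (\<lambda>k. norm (fourier f k))" using intF by simp
    show "AE k in lborel. norm (fourier f k * gaussian (t m) k) \<le> norm (fourier f k)" for m
      by (auto simp: norm_mult norm_gaussian intro!: mult_left_le)
    show "AE k in lborel. (\<lambda>m. fourier f k * gaussian (t m) k) \<longlonglongrightarrow> fourier f k"
    proof (rule AE_I2)
      fix k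
      have "(\<lambda>m. fourier f k * gaussian (t m) k) \<longlonglongrightarrow> fourier f k * complex_of_real (exp (- (0\<^sup>2 * (norm k)\<^sup>2 / 2)))"
        unfolding gaussian_def by (intro tendsto_intros t0) auto
      then show "(\<lambda>m. fourier f k * gaussian (t m) k) \<longlonglongrightarrow> fourier f k" by simp
    qed
  qed measurable
  \<comment> \<open>The substitution of \<open>t m *\<^sub>R x\<close> for \<open>x\<close> yields a
    power of \<open>t m\<close> that cancels the one in the transformed Gaussian, leaving the fixed
    weight \<open>gaussian 1\<close>.\<close>
  have 2: "(\<integral>k. fourier f k * gaussian (t m) k \<partial>lborel) = ?c * (\<integral>x. f (t m *\<^sub>R x) * gaussian 1 x \<partial>lborel)" for m
  proof -
    have "(\<integral>k. fourier f k * gaussian (t m) k \<partial>lborel) = (\<integral>x. f x * fourier (gaussian (t m)) x \<partial>lborel)"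
      by (rule integral_fourier_mult[OF int gi[OF t]])
    also have "\<dots> = t m ^ DIM(real^'n) *\<^sub>R (\<integral>x. f (t m *\<^sub>R x) * fourier (gaussian (t m)) (t m *\<^sub>R x) \<partial>lborel)"
      unfolding fourier_gaussian[OF t]
      by (rule lborel_integral_scale[OF _ t]) measurable
    also have "(\<integral>x. f (t m *\<^sub>R x) * fourier (gaussian (t m)) (t m *\<^sub>R x) \<partial>lborel) =
       (\<integral>x. complex_of_real ((sqrt (2 * pi) / t m) ^ CARD('n)) * (f (t m *\<^sub>R x) * gaussian 1 x) \<partial>lborel)"
      using t[of m] by (intro Bochner_Integration.integral_cong)
        (auto simp: fourier_gaussian gaussian_def power_mult_distrib power_divide)
    finally show ?thesis
      using t[of m] by (simp add: scaleR_conv_of_real power_divide)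
  qed
  have 3: "(\<lambda>m. \<integral>x. f (t m *\<^sub>R x) * gaussian 1 x \<partial>lborel) \<longlonglongrightarrow> (\<integral>x. f 0 * gaussian 1 x \<partial>(lborel :: (real^'n) measure))"
  proof (rule integral_dominated_convergence)
    show "integrable lborel (\<lambda>x::real^'n. B * norm (gaussian 1 x))"
      by (intro integrable_mult_right integrable_norm gi) simp
    show "AE x in lborel. norm (f (t m *\<^sub>R x) * gaussian 1 x) \<le> B * norm (gaussian 1 x)" for m
      by (auto simp: norm_mult intro!: mult_right_mono bound)
    show "AE x in lborel. (\<lambda>m. f (t m *\<^sub>R x) * gaussian 1 x) \<longlonglongrightarrow> f 0 * gaussian 1 x"
    proof (rule AE_I2)
      fix x :: "real^'n"
      have "(\<lambda>m. t m *\<^sub>R x) \<longlonglongrightarrow> 0 *\<^sub>R x" by (intro tendsto_intros t0)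
      then have "(\<lambda>m. f (t m *\<^sub>R x)) \<longlonglongrightarrow> f 0"
        using cont by (intro isCont_tendsto_compose[of _ f]) (auto simp: continuous_on_eq_continuous_at)
      then show "(\<lambda>m. f (t m *\<^sub>R x) * gaussian 1 x) \<longlonglongrightarrow> f 0 * gaussian 1 x"
        by (rule tendsto_mult_right)
    qed
  qed measurable
  \<comment> \<open>The mass of the Gaussian is its transform at frequency 0.\<close>
  have 4: "(\<integral>x. gaussian 1 x \<partial>(lborel :: (real^'n) measure)) = ?c"
    using fourier_gaussian[of 1 "0::real^'n"] by (simp add: fourier_eq_lborel) (simp add: gaussian_def)
  have "(\<lambda>m. \<integral>k. fourier f k * gaussian (t m) k \<partial>lborel) \<longlonglongrightarrow> ?c * (f 0 * ?c)"
    unfolding 2 using tendsto_mult_left[OF 3, of ?c] unfolding integral_mult_right_zero 4 .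
  from LIMSEQ_unique[OF 1 this]
  have "(\<integral>k. fourier f k \<partial>lborel) = complex_of_real ((sqrt (2 * pi) * sqrt (2 * pi)) ^ CARD('n)) * f 0"
    by (simp only: power_mult_distrib of_real_mult mult_ac)
  then show ?thesis by simp
qed

text \<open>Modulating the transform by \<open>cis (- (x \<bullet> k))\<close> is translating
  \<open>f\<close>, which reduces the value at \<open>- x\<close> to inversion at the
  origin.\<close>

lemma fourier_fourier:
  fixes f :: "real^'n::finite \<Rightarrow> complex"
  assumes f: "f \<in> schwartz"
  shows "fourier (fourier f) x = complex_of_real ((2 * pi) ^ CARD('n)) * f (- x)"
proof -
  have rf: "rapidly_decreasing f" by (rule schwartz_rapidly_decreasing[OF f])
  have rF: "rapidly_decreasing (fourier f)" by (rule rapidly_decreasing_fourier[OF f])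
  have [measurable]: "f \<in> borel_measurable borel" "fourier f \<in> borel_measurable borel"
    using rf rF by measurable
  obtain B where B: "\<And>x. norm (f x) \<le> B / (1 + norm x) ^ 0"
    using rapidly_decreasing_bound[OF rf] by blast
  let ?f = "\<lambda>y. f (y + (- x))"
  have F: "fourier ?f k = fourier f k * cis (- (x \<bullet> k))" for k
    by (subst fourier_translate) (auto simp: inner_commute)
  have "fourier (fourier f) x = (\<integral>k. fourier ?f k \<partial>lborel)"
    unfolding F by (rule fourier_eq_lborel) measurable
  also have "\<dots> = complex_of_real ((2 * pi) ^ CARD('n)) * ?f 0"
  proof (rule integral_fourier)
    have "integrable (distr lborel borel ((+) (- x))) f"
      by (simp add: lborel_distr_plus rapidly_decreasing_integrable rf)
    then show "integrable lborel ?f"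
      by (subst (asm) integrable_distr_eq) (auto simp: add.commute)
    show "continuous_on UNIV ?f"
      using rf by (intro continuous_on_compose2[of UNIV f UNIV "\<lambda>y. y + - x"] continuous_intros)
        (auto simp: rapidly_decreasing_def)
    show "norm (?f y) \<le> B" for y using B by simp
    show "integrable lborel (fourier ?f)"
      unfolding F by (intro integrable_mult_cis rapidly_decreasing_integrable rF) measurable
  qed
  finally show ?thesis by simp
qed

text \<open>The fourth power of the Fourier transform is a scalar, so its cube inverts it up to a constant.\<close>
lemma schwartz_fourier_surj:
  fixes f :: "real^'n::finite \<Rightarrow> complex"
  assumes "f \<in> schwartz"
  obtains g where "g \<in> schwartz" "fourier g = f"
proof -
  let ?c = "complex_of_real ((2 * pi) ^ CARD('n))"
  let ?h = "fourier (fourier (fourier f))"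
  have h: "?h \<in> schwartz" by (intro schwartz_fourier assms)
  then have [measurable]: "?h \<in> borel_measurable borel"
    using schwartz_rapidly_decreasing by measurable
  have "fourier (\<lambda>x. (inverse ?c)\<^sup>2 * ?h x) = f"
  proof
    fix x
    have "fourier (\<lambda>x. (inverse ?c)\<^sup>2 * ?h x) x = (inverse ?c)\<^sup>2 * (?c * (?c * f (- (- x))))"
      by (subst fourier_cmult, fact) (simp only: fourier_fourier[OF schwartz_fourier[OF schwartz_fourier[OF assms]]] fourier_fourier[OF assms])
    also have "\<dots> = (inverse ?c * ?c)\<^sup>2 * f x"
      by (simp only: power2_eq_square minus_minus mult_ac)
    also have "inverse ?c * ?c = 1"
      by (rule left_inverse) simp
    finally show "fourier (\<lambda>x. (inverse ?c)\<^sup>2 * ?h x) x = f x" by simp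
  qed
  with schwartz_cmult[OF h] show ?thesis using that by blast
qed

section \<open>Kernels dominated by the inverse norm\<close>

text \<open>The two coefficients let one formula cover the kernel, its majorant and 1/|x|. The
  half-line is open, as the substitution of 1 / r for r demands.\<close>

lemma half_gaussian_moments:
  assumes a: "a > 0"
  shows "has_bochner_integral lborel (\<lambda>r. indicator {0<..} r * ((\<alpha> + \<beta> * r\<^sup>2) * exp (- (r\<^sup>2 * a\<^sup>2 / 2))))
    (sqrt (pi / 2) * (\<alpha> / a + \<beta> / a ^ 3))"
proof -
  \<comment> \<open>Rescaling by \<open>c\<close> reduces the exponent to that of exp(-
    x^2).\<close>
  define c where "c = a / sqrt 2"
  have c: "c > 0" "c\<^sup>2 = a\<^sup>2 / 2" using a by (simp_all add: c_def power_divide)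
  have ind: "indicator {0..} (0 + c * r) = (indicator {0..} r :: real)" for r
    using c by (auto simp: indicator_def zero_le_mult_iff)
  have 0: "has_bochner_integral lborel (\<lambda>r. indicator {0..} r * exp (- (r\<^sup>2 * a\<^sup>2 / 2))) (sqrt (pi / 2) / a)"
  proof -
    have "has_bochner_integral lborel (\<lambda>r. indicator {0..} (0 + c * r) *\<^sub>R exp (- (0 + c * r)\<^sup>2)) ((sqrt pi / 2) /\<^sub>R \<bar>c\<bar>)"
      using gaussian_moment_0 c by (subst (asm) lborel_has_bochner_integral_real_affine_iff[where c = c and t = 0]) auto
    moreover have "(sqrt pi / 2) /\<^sub>R \<bar>c\<bar> = sqrt (pi / 2) / a"
      using a by (simp add: c_def real_sqrt_divide field_simps)
    ultimately show ?thesis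
      unfolding ind by (simp add: power_mult_distrib c(2) mult.commute)
  qed
  have 1: "has_bochner_integral lborel (\<lambda>r. indicator {0..} r * (r\<^sup>2 * exp (- (r\<^sup>2 * a\<^sup>2 / 2)))) (sqrt (pi / 2) / a ^ 3)"
  proof -
    have "has_bochner_integral lborel (\<lambda>x. indicator {0..} x *\<^sub>R (exp (- x\<^sup>2) * x\<^sup>2)) (sqrt pi / 4)"
      using gaussian_moment_even_pos[of 1] by (simp add: fact_numeral)
    then have "has_bochner_integral lborel (\<lambda>r. indicator {0..} (0 + c * r) *\<^sub>R (exp (- (0 + c * r)\<^sup>2) * (0 + c * r)\<^sup>2)) ((sqrt pi / 4) /\<^sub>R \<bar>c\<bar>)"
      using c by (subst (asm) lborel_has_bochner_integral_real_affine_iff[where c = c and t = 0]) auto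
    \<comment> \<open>\<open>2 / a\<^sup>2\<close> is the inverse of \<open>c\<^sup>2\<close> and
      undoes the scaling of the factor r^2.\<close>
    from has_bochner_integral_mult_right[OF this, of "2 / a\<^sup>2"]
    have "has_bochner_integral lborel (\<lambda>r. 2 / a\<^sup>2 * (indicator {0..} r * (exp (- (a\<^sup>2 / 2 * r\<^sup>2)) * (a\<^sup>2 / 2 * r\<^sup>2))))
       (2 / a\<^sup>2 * ((sqrt pi / 4) /\<^sub>R \<bar>c\<bar>))"
      unfolding ind by (simp add: power_mult_distrib c(2))
    moreover have "2 / a\<^sup>2 * ((sqrt pi / 4) /\<^sub>R \<bar>c\<bar>) = sqrt (pi / 2) / a ^ 3"
      using a by (simp add: c_def real_sqrt_divide field_simps power2_eq_square power3_eq_cube)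
    moreover have "(\<lambda>r. 2 / a\<^sup>2 * (indicator {0..} r * (exp (- (a\<^sup>2 / 2 * r\<^sup>2)) * (a\<^sup>2 / 2 * r\<^sup>2))))
       = (\<lambda>r. indicator {0..} r * (r\<^sup>2 * exp (- (r\<^sup>2 * a\<^sup>2 / 2))))"
      using a by (simp add: fun_eq_iff field_simps)
    ultimately show ?thesis by simp
  qed
  have "has_bochner_integral lborel (\<lambda>r. \<alpha> * (indicator {0..} r * exp (- (r\<^sup>2 * a\<^sup>2 / 2)))
      + \<beta> * (indicator {0..} r * (r\<^sup>2 * exp (- (r\<^sup>2 * a\<^sup>2 / 2))))) (\<alpha> * (sqrt (pi / 2) / a) + \<beta> * (sqrt (pi / 2) / a ^ 3))"
    by (intro has_bochner_integral_add has_bochner_integral_mult_right 0 1)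
  then have *: "has_bochner_integral lborel (\<lambda>r. indicator {0..} r * ((\<alpha> + \<beta> * r\<^sup>2) * exp (- (r\<^sup>2 * a\<^sup>2 / 2))))
    (sqrt (pi / 2) * (\<alpha> / a + \<beta> / a ^ 3))"
    by (simp add: algebra_simps)
  show ?thesis
  proof (rule has_bochner_integralI_AE[OF *])
    show "AE r in lborel. indicator {0..} r * ((\<alpha> + \<beta> * r\<^sup>2) * exp (- (r\<^sup>2 * a\<^sup>2 / 2)))
      = indicator {0<..} r * ((\<alpha> + \<beta> * r\<^sup>2) * exp (- (r\<^sup>2 * a\<^sup>2 / 2)))"
      using AE_lborel_singleton[of 0] by eventually_elim (auto simp: indicator_def)
  qed measurable
qed

text \<open>Under the substitution of 1 / r for r the Jacobian 1 / r^2 turns \<alpha> + \<beta> r^2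
  into \<alpha> / r^2 + \<beta> / r^4, the shape of the transformed Gaussians. The value is
  therefore that of \<open>half_gaussian_moments\<close>.\<close>

lemma half_gaussian_inverse_moments:
  assumes a: "a > 0"
  shows "has_bochner_integral lborel
    (\<lambda>r. indicator {0<..} r * ((\<alpha> / r\<^sup>2 + \<beta> / r ^ 4) * exp (- ((1 / r)\<^sup>2 * a\<^sup>2 / 2))))
    (sqrt (pi / 2) * (\<alpha> / a + \<beta> / a ^ 3))"
proof -
  let ?h = "\<lambda>r. (\<alpha> + \<beta> * r\<^sup>2) * exp (- (r\<^sup>2 * a\<^sup>2 / 2))"
  let ?b = "sqrt (pi / 2) * (\<alpha> / a + \<beta> / a ^ 3)"
  \<comment> \<open>A bridge from Bochner integrals over \<open>lborel\<close> to absolute gauge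
    integrability on the half-line, the setting of the change of variables theorem.\<close>
  have iff: "has_bochner_integral lborel (\<lambda>r. indicator {0<..} r * u r) b
      \<longleftrightarrow> u absolutely_integrable_on {0<..} \<and> integral {0<..} u = b"
    if "u \<in> borel_measurable borel" for u :: "real \<Rightarrow> real" and b
  proof -
    note [measurable] = that
    have "has_bochner_integral lborel (\<lambda>r. indicator {0<..} r * u r) b
      \<longleftrightarrow> set_integrable lebesgue {0<..} u \<and> set_lebesgue_integral lebesgue {0<..} u = b"
      by (simp add: has_bochner_integral_iff set_integrable_def set_lebesgue_integral_def
          integrable_completion integral_completion)
    then show ?thesis by (auto simp: set_lebesgue_integral_eq_integral)
  qed
  have image: "(\<lambda>r. 1 / r) ` {0<..} = {0::real<..}"
  proof (intro equalityI subsetI)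
    fix x :: real assume "x \<in> {0<..}"
    then show "x \<in> (\<lambda>r. 1 / r) ` {0<..}" by (intro image_eqI[of _ _ "1 / x"]) auto
  qed auto
  have der: "((\<lambda>r. 1 / r) has_field_derivative - 1 / r\<^sup>2) (at r within {0<..})" if "r \<in> {0<..}" for r :: real
    using that by (auto intro!: derivative_eq_intros simp: power2_eq_square)
  have "?h absolutely_integrable_on {0<..} \<and> integral {0<..} ?h = ?b"
    using half_gaussian_moments[OF a] by (subst (asm) iff) measurable
  then have "(\<lambda>r. \<bar>- 1 / r\<^sup>2\<bar> * ?h (1 / r)) absolutely_integrable_on {0<..} \<and>
      integral {0<..} (\<lambda>r. \<bar>- 1 / r\<^sup>2\<bar> * ?h (1 / r)) = ?b"
    using has_absolute_integral_change_of_variables_1'[of "{0<..}" "\<lambda>r. 1 / r" "\<lambda>r. - 1 / r\<^sup>2" ?h ?b] der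
    unfolding image by (auto simp: inj_on_def)
  then have "has_bochner_integral lborel (\<lambda>r. indicator {0<..} r * (\<bar>- 1 / r\<^sup>2\<bar> * ?h (1 / r))) ?b"
    by (subst iff) measurable
  moreover have "(\<lambda>r. indicator {0<..} r * (\<bar>- 1 / r\<^sup>2\<bar> * ?h (1 / r))) =
      (\<lambda>r. indicator {0<..} r * ((\<alpha> / r\<^sup>2 + \<beta> / r ^ 4) * exp (- ((1 / r)\<^sup>2 * a\<^sup>2 / 2))))"
    by (auto simp: fun_eq_iff indicator_def field_simps power2_eq_square power4_eq_xxxx)
  ultimately show ?thesis by simp
qed

text \<open>$1/|x|$ is itself a superposition of Gaussians, and the total mass of
  $e^{-(1+r^2)|x|^2/2}$ on the plane is $2\pi/(1+r^2)$, which is integrable in $r$.\<close>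
lemma integrable_norm_kernel_gaussian:
  "integrable lborel (\<lambda>x::real^2. exp (- ((norm x)\<^sup>2 / 2)) / norm x)"
proof -
  let ?w = "\<lambda>(x::real^2) r. indicator {0<..} r * (exp (- (r\<^sup>2 * (norm x)\<^sup>2 / 2)) * exp (- ((norm x)\<^sup>2 / 2)))"
  have mult: "exp (- (r\<^sup>2 * (norm x)\<^sup>2 / 2)) * exp (- ((norm x)\<^sup>2 / 2)) = norm (gaussian (sqrt (1 + r\<^sup>2)) x)" for r and x :: "real^2"
    by (simp add: norm_gaussian exp_add[symmetric] algebra_simps add_divide_distrib)
  have g: "rapidly_decreasing (gaussian (sqrt (1 + r\<^sup>2)) :: real^2 \<Rightarrow> complex)" for r
    by (rule rapidly_decreasing_gaussian) (simp add: add_pos_nonneg)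
  have total: "(\<integral>x. norm (gaussian (sqrt (1 + r\<^sup>2)) x) \<partial>(lborel :: (real^2) measure)) = 2 * pi * inverse (1 + r\<^sup>2)" for r
  proof -
    have pos: "sqrt (1 + r\<^sup>2) > 0" by (simp add: add_pos_nonneg)
    \<comment> \<open>The mass is the transform at frequency 0; dimension 2 produces the square and
      hence 1 / (1 + r^2).\<close>
    have "complex_of_real (\<integral>x. norm (gaussian (sqrt (1 + r\<^sup>2)) x) \<partial>(lborel :: (real^2) measure))
      = fourier (gaussian (sqrt (1 + r\<^sup>2))) (0 :: real^2)"
      by (simp add: fourier_eq_lborel norm_gaussian) (simp add: gaussian_def)
    also have "\<dots> = complex_of_real ((sqrt (2 * pi) / sqrt (1 + r\<^sup>2))\<^sup>2)"
      by (simp add: fourier_gaussian[OF pos]) (simp add: gaussian_def)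
    also have "(sqrt (2 * pi) / sqrt (1 + r\<^sup>2))\<^sup>2 = 2 * pi * inverse (1 + r\<^sup>2)"
      unfolding power_divide by (simp add: divide_inverse)
    finally show ?thesis by (simp only: of_real_eq_iff)
  qed
  have "integrable (lborel \<Otimes>\<^sub>M lborel) (\<lambda>(r, x). ?w x r)"
  proof (rule lborel_pair.Fubini_integrable)
    show "(\<lambda>(r, x). ?w x r) \<in> borel_measurable (lborel \<Otimes>\<^sub>M lborel)" by measurable
    have "integrable lborel (\<lambda>x::real. inverse (1 + x\<^sup>2))"
      using integrable_inverse_1_plus_square by (simp add: set_integrable_def)
    then have "integrable lborel (\<lambda>r::real. indicator {0<..} r *\<^sub>R (2 * pi * inverse (1 + r\<^sup>2)))"
      by (intro integrable_mult_indicator integrable_mult_right) auto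
    then show "integrable lborel (\<lambda>r. \<integral>x. norm (case (r, x) of (r, x) \<Rightarrow> ?w x r) \<partial>lborel)"
      by (simp add: mult total)
    show "AE r in lborel. integrable lborel (\<lambda>x. case (r, x) of (r, x) \<Rightarrow> ?w x r)"
      by (rule AE_I2) (auto simp: mult intro!: integrable_mult_right integrable_norm rapidly_decreasing_integrable g)
  qed
  from lborel_pair.integrable_snd[OF this]
  have "integrable lborel (\<lambda>x. \<integral>r. ?w x r \<partial>lborel)" .
  \<comment> \<open>For x \<noteq> 0 the r-integral of exp(- r^2 |x|^2 / 2) over the half-line is
    \<open>sqrt (pi / 2) / norm x\<close>; the factor removes its constant.\<close>
  from integrable_mult_right[OF this, of "1 / sqrt (pi / 2)"]
  show ?thesis
  proof (rule integrable_cong_AE_imp)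
    show "AE x in lborel. 1 / sqrt (pi / 2) * (\<integral>r. ?w x r \<partial>lborel) = exp (- ((norm x)\<^sup>2 / 2)) / norm x"
      using AE_lborel_singleton[of "0::real^2"]
    proof eventually_elim
      case (elim x)
      have "has_bochner_integral lborel (\<lambda>r. exp (- ((norm x)\<^sup>2 / 2)) * (indicator {0<..} r * ((1 + 0 * r\<^sup>2) * exp (- (r\<^sup>2 * (norm x)\<^sup>2 / 2)))))
         (exp (- ((norm x)\<^sup>2 / 2)) * (sqrt (pi / 2) * (1 / norm x + 0 / norm x ^ 3)))"
        using elim by (intro has_bochner_integral_mult_right half_gaussian_moments) simp
      then have "has_bochner_integral lborel (?w x) (exp (- ((norm x)\<^sup>2 / 2)) * sqrt (pi / 2) / norm x)"
        by (simp add: mult_ac)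
      then have "(\<integral>r. ?w x r \<partial>lborel) = exp (- ((norm x)\<^sup>2 / 2)) * sqrt (pi / 2) / norm x"
        by (rule has_bochner_integral_integral_eq)
      then show ?case by simp
    qed
  qed measurable
qed

text \<open>On the unit ball the Gaussian times exp(1/2) is at least 1, so the singular Gaussian
  kernel dominates; outside it 1/|x| is at most 1. The exponent 4 is twice the dimension.\<close>

lemma integrable_norm_kernel:
  "integrable lborel (\<lambda>x::real^2. 1 / norm x * (1 / (1 + norm x) ^ 4))"
proof (rule Bochner_Integration.integrable_bound)
  show "integrable lborel (\<lambda>x::real^2. exp (1 / 2) * (exp (- ((norm x)\<^sup>2 / 2)) / norm x) + 1 / (1 + norm x) ^ 4)"
    using integrable_inverse_power_norm[where 'a = "real^2"]
    by (intro Bochner_Integration.integrable_add integrable_mult_right integrable_norm_kernel_gaussian) simp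
  show "AE x in lborel. norm (1 / norm x * (1 / (1 + norm x) ^ 4))
    \<le> norm (exp (1 / 2) * (exp (- ((norm (x::real^2))\<^sup>2 / 2)) / norm x) + 1 / (1 + norm x) ^ 4)"
  proof (rule AE_I2)
    fix x :: "real^2"
    have p: "1 \<le> (1 + norm x) ^ 4" by (intro one_le_power) simp
    have "1 / norm x * (1 / (1 + norm x) ^ 4) \<le> exp (1 / 2) * (exp (- ((norm x)\<^sup>2 / 2)) / norm x) + 1 / (1 + norm x) ^ 4"
    proof (cases "norm x \<le> 1")
      case True
      then have "(norm x)\<^sup>2 \<le> 1" by (simp add: power_le_one)
      then have "1 \<le> exp (1 / 2 + (- ((norm x)\<^sup>2 / 2)))" by simp
      then have e: "1 \<le> exp (1 / 2) * exp (- ((norm x)\<^sup>2 / 2))" by (simp only: exp_add)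
      have "1 / norm x * (1 / (1 + norm x) ^ 4) \<le> 1 / norm x * 1"
        using p by (intro mult_left_mono) (auto simp: divide_le_eq)
      also have "\<dots> \<le> 1 / norm x * (exp (1 / 2) * exp (- ((norm x)\<^sup>2 / 2)))"
        by (intro mult_left_mono e) simp
      finally show ?thesis using p by (simp add: add_increasing2)
    next
      case False
      then have "1 / norm x * (1 / (1 + norm x) ^ 4) \<le> 1 * (1 / (1 + norm x) ^ 4)"
        by (intro mult_right_mono) (auto simp: divide_le_eq)
      then show ?thesis by (simp add: add_increasing)
    qed
    then show "norm (1 / norm x * (1 / (1 + norm x) ^ 4))
      \<le> norm (exp (1 / 2) * (exp (- ((norm x)\<^sup>2 / 2)) / norm x) + 1 / (1 + norm x) ^ 4)"
      by simp
  qed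
qed measurable

text \<open>At the origin \<open>C / norm x\<close> is 0, so the bound forces
  \<open>g 0 = 0\<close>; both \<open>stokes_kernel\<close> and \<open>stokes_symbol\<close> comply
  by the same convention for division.\<close>

lemma kernel_integrable:
  fixes g f :: "real^2 \<Rightarrow> complex"
  assumes g: "g \<in> borel_measurable borel" "\<And>x. norm (g x) \<le> C / norm x" and f: "rapidly_decreasing f"
  shows "integrable lborel (\<lambda>x. g x * f x)"
proof -
  obtain D where D: "D > 0" "\<And>x. norm (f x) \<le> D / (1 + norm x) ^ 4"
    using rapidly_decreasing_bound[OF f] by blast
  have [measurable]: "g \<in> borel_measurable borel" "f \<in> borel_measurable borel" using g f by measurable
  show ?thesis
  proof (rule Bochner_Integration.integrable_bound)
    show "integrable lborel (\<lambda>x::real^2. (C * D) * (1 / norm x * (1 / (1 + norm x) ^ 4)))"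
      by (intro integrable_mult_right integrable_norm_kernel)
    show "AE x in lborel. norm (g x * f x) \<le> norm ((C * D) * (1 / norm x * (1 / (1 + norm x) ^ 4)))"
    proof (rule AE_I2)
      fix x
      have "norm (g x * f x) \<le> (C / norm x) * (D / (1 + norm x) ^ 4)"
        unfolding norm_mult by (rule mult_mono[OF g(2) D(2) order.trans[OF norm_ge_zero g(2)] norm_ge_zero])
      also have "\<dots> = (C * D) * (1 / norm x * (1 / (1 + norm x) ^ 4))" by simp
      also have "\<dots> \<le> norm \<dots>" by (simp only: real_norm_def abs_ge_self)
      finally show "norm (g x * f x) \<le> norm ((C * D) * (1 / norm x * (1 / (1 + norm x) ^ 4)))" .
    qed
  qed measurable
qed

text \<open>Fubini needs the r-integral of |w|. Since \<open>w\<close> may change sign in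
  \<open>r\<close>, the moment formulas do not give it; the majorant \<open>v\<close> has a known
  integral \<open>V\<close> of order 1/|x|, which is integrable against a rapidly decreasing
  function. The origin, where the moments fail, is a null set.\<close>

lemma integral_kernel_swap:
  fixes w v :: "real^2 \<Rightarrow> real \<Rightarrow> real"
  assumes [measurable]: "case_prod w \<in> borel_measurable (borel \<Otimes>\<^sub>M borel)"
    and f: "rapidly_decreasing f"
    and w: "\<And>x r. x \<noteq> 0 \<Longrightarrow> \<bar>w x r\<bar> \<le> v x r"
    and v: "\<And>x. x \<noteq> 0 \<Longrightarrow> has_bochner_integral lborel (v x) (V x)"
    and V: "\<And>x. x \<noteq> 0 \<Longrightarrow> V x \<le> C / norm x"
  shows "(\<integral>x. complex_of_real (\<integral>r. w x r \<partial>lborel) * f x \<partial>lborel)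
    = (\<integral>r. \<integral>x. complex_of_real (w x r) * f x \<partial>lborel \<partial>lborel)"
proof -
  have [measurable]: "f \<in> borel_measurable borel" using f by measurable
  have wi: "integrable lborel (w x)" if "x \<noteq> 0" for x
  proof (rule Bochner_Integration.integrable_bound)
    show "integrable lborel (v x)" using v[OF that] by (simp add: has_bochner_integral_iff)
    show "w x \<in> borel_measurable lborel"
      using measurable_Pair2[OF assms(1), of x] by simp
    show "AE r in lborel. norm (w x r) \<le> norm (v x r)"
      using order.trans[OF w[OF that] abs_ge_self] by simp
  qed
  have wV: "(\<integral>r. \<bar>w x r\<bar> \<partial>lborel) \<le> C / norm x" if "x \<noteq> 0" for x
  proof -
    have "(\<integral>r. \<bar>w x r\<bar> \<partial>lborel) \<le> (\<integral>r. v x r \<partial>lborel)"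
      using v[OF that] wi[OF that] w[OF that] by (intro integral_mono) (auto simp: has_bochner_integral_iff)
    also have "\<dots> = V x" using v[OF that] by (simp add: has_bochner_integral_iff)
    finally show ?thesis using V[OF that] by simp
  qed
  have int: "integrable (lborel \<Otimes>\<^sub>M lborel) (\<lambda>(x, r). complex_of_real (w x r) * f x)"
  proof (rule lborel_pair.Fubini_integrable)
    show "(\<lambda>(x, r). complex_of_real (w x r) * f x) \<in> borel_measurable (lborel \<Otimes>\<^sub>M lborel)"
      by measurable
    have "integrable lborel (\<lambda>x. complex_of_real (C / norm x) * f x)"
      by (rule kernel_integrable[where C = "\<bar>C\<bar>", OF _ _ f]) (auto simp: norm_divide)
    from integrable_norm[OF this]
    show "integrable lborel (\<lambda>x. \<integral>r. norm (case (x, r) of (x, r) \<Rightarrow> complex_of_real (w x r) * f x) \<partial>lborel)"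
    proof (rule Bochner_Integration.integrable_bound)
      show "AE x in lborel. norm (\<integral>r. norm (case (x, r) of (x, r) \<Rightarrow> complex_of_real (w x r) * f x) \<partial>lborel)
         \<le> norm (norm (complex_of_real (C / norm x) * f x))"
        using AE_lborel_singleton[of "0::real^2"]
      proof eventually_elim
        case (elim x)
        have "norm (\<integral>r. norm (case (x, r) of (x, r) \<Rightarrow> complex_of_real (w x r) * f x) \<partial>lborel)
           = (\<integral>r. \<bar>w x r\<bar> \<partial>lborel) * norm (f x)"
          by (simp add: norm_mult abs_mult)
        also have "\<dots> \<le> \<bar>C / norm x\<bar> * norm (f x)"
          by (intro mult_right_mono order.trans[OF wV[OF elim] abs_ge_self]) simp
        finally show ?case by (simp add: norm_mult norm_divide)
      qed
    qed measurable
    show "AE x in lborel. integrable lborel (\<lambda>r. case (x, r) of (x, r) \<Rightarrow> complex_of_real (w x r) * f x)"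
      using AE_lborel_singleton[of "0::real^2"]
      by eventually_elim (auto intro!: integrable_mult_left integrable_of_real wi)
  qed
  have "(\<integral>x. complex_of_real (\<integral>r. w x r \<partial>lborel) * f x \<partial>lborel)
      = (\<integral>x. \<integral>r. complex_of_real (w x r) * f x \<partial>lborel \<partial>lborel)"
    by simp
  also have "\<dots> = (\<integral>r. \<integral>x. complex_of_real (w x r) * f x \<partial>lborel \<partial>lborel)"
    by (rule lborel_pair.Fubini_integral[OF int, symmetric])
  finally show ?thesis .
qed

section \<open>The fundamental solution\<close>

text \<open>The orthogonal projection onto the complement of k (the Leray projection) divided by
  |k|. It is real-valued, and division by zero makes it 0 at the origin.\<close>

definition stokes_symbol :: "'n::finite \<Rightarrow> 'n \<Rightarrow> real^'n \<Rightarrow> real" where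
  "stokes_symbol i j k = (if i = j then 1 else 0) / norm k - k $ i * k $ j / norm k ^ 3"

definition stokes_kernel :: "'n::finite \<Rightarrow> 'n \<Rightarrow> real^'n \<Rightarrow> real" where
  "stokes_kernel i j x = x $ i * x $ j / (2 * pi * norm x ^ 3)"

lemma borel_measurable_stokes [measurable]:
  "stokes_symbol i j \<in> borel_measurable borel" "stokes_kernel i j \<in> borel_measurable borel"
  unfolding stokes_symbol_def stokes_kernel_def by measurable

lemma abs_component_mult_le: "\<bar>x $ i * x $ j\<bar> \<le> (norm (x::real^'n::finite))\<^sup>2"
  unfolding abs_mult power2_eq_square by (intro mult_mono component_le_norm_cart) auto

lemma abs_component_mult_div_le: "\<bar>x $ i * x $ j / norm x ^ 3\<bar> \<le> 1 / norm (x::real^'n::finite)"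
proof (cases "x = 0")
  case False
  then have "\<bar>x $ i * x $ j / norm x ^ 3\<bar> \<le> (norm x)\<^sup>2 / norm x ^ 3"
    using abs_component_mult_le[of x i j] by (simp add: divide_right_mono)
  then show ?thesis using False by (simp add: power2_eq_square power3_eq_cube)
qed simp

lemma abs_stokes_symbol_le: "\<bar>stokes_symbol i j k\<bar> \<le> 2 / norm k"
proof -
  have "\<bar>stokes_symbol i j k\<bar> \<le> 1 / norm k + 1 / norm k"
    unfolding stokes_symbol_def
    by (rule order.trans[OF abs_triangle_ineq4 add_mono[OF _ abs_component_mult_div_le]]) simp
  then show ?thesis by simp
qed

lemma abs_stokes_kernel_le: "\<bar>stokes_kernel i j x\<bar> \<le> (1 / (2 * pi)) / norm x"
proof -
  have "\<bar>stokes_kernel i j x\<bar> = 1 / (2 * pi) * \<bar>x $ i * x $ j / norm x ^ 3\<bar>"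
    by (simp add: stokes_kernel_def abs_mult)
  also have "\<dots> \<le> 1 / (2 * pi) * (1 / norm x)"
    by (intro mult_left_mono abs_component_mult_div_le) simp
  finally show ?thesis by simp
qed

text \<open>The weak form of the statement that the symbol is the transform of the kernel.\<close>

lemma fourier_stokes_kernel:
  fixes \<phi> :: "real^2 \<Rightarrow> complex"
  assumes \<phi>: "\<phi> \<in> schwartz"
  shows "(\<integral>x. complex_of_real (stokes_kernel i j x) * fourier \<phi> x \<partial>lborel)
    = (\<integral>k. complex_of_real (stokes_symbol i j k) * \<phi> k \<partial>lborel)"
proof -
  define c where "c = sqrt (pi / 2)"
  have c: "c > 0" by (simp add: c_def)
  have r\<phi>: "rapidly_decreasing \<phi>" by (rule schwartz_rapidly_decreasing[OF \<phi>])
  have rF: "rapidly_decreasing (fourier \<phi>)" by (rule rapidly_decreasing_fourier[OF \<phi>])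
  let ?\<delta> = "if i = j then 1 else 0 :: real"
  \<comment> \<open>\<open>?w2\<close> is the transform of \<open>?w1\<close> in space divided by 2
    pi, and \<open>?v1\<close>, \<open>?v2\<close> are the sign-free majorants. The summand 0 keeps
    the shape of \<open>half_gaussian_moments\<close>.\<close>
  let ?w1 = "\<lambda>(x::real^2) r. indicator {0<..} r * ((0 + x $ i * x $ j * r\<^sup>2) * exp (- (r\<^sup>2 * (norm x)\<^sup>2 / 2)))"
  let ?v1 = "\<lambda>(x::real^2) r. indicator {0<..} r * ((0 + (norm x)\<^sup>2 * r\<^sup>2) * exp (- (r\<^sup>2 * (norm x)\<^sup>2 / 2)))"
  let ?w2 = "\<lambda>(k::real^2) r. indicator {0<..} r * ((?\<delta> / r\<^sup>2 + (- (k $ i * k $ j)) / r ^ 4) * exp (- ((1 / r)\<^sup>2 * (norm k)\<^sup>2 / 2)))"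
  let ?v2 = "\<lambda>(k::real^2) r. indicator {0<..} r * ((1 / r\<^sup>2 + (norm k)\<^sup>2 / r ^ 4) * exp (- ((1 / r)\<^sup>2 * (norm k)\<^sup>2 / 2)))"
  have sq: "(norm x)\<^sup>2 / norm x ^ 3 = 1 / norm x" if "x \<noteq> 0" for x :: "real^2"
    using that by (simp add: power2_eq_square power3_eq_cube)
  have 1: "(\<integral>x. complex_of_real (\<integral>r. ?w1 x r \<partial>lborel) * fourier \<phi> x \<partial>lborel)
    = (\<integral>r. \<integral>x. complex_of_real (?w1 x r) * fourier \<phi> x \<partial>lborel \<partial>lborel)"
  proof (rule integral_kernel_swap[OF _ rF])
    show "case_prod ?w1 \<in> borel_measurable (borel \<Otimes>\<^sub>M borel)" by measurable
    show "\<bar>?w1 x r\<bar> \<le> ?v1 x r" for x r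
      using mult_right_mono[OF abs_component_mult_le[of x i j], of "r\<^sup>2"]
      by (auto simp: abs_mult intro!: mult_left_mono mult_right_mono)
    show "has_bochner_integral lborel (?v1 x) (c * (0 / norm x + (norm x)\<^sup>2 / norm x ^ 3))" if "x \<noteq> 0" for x
      unfolding c_def using that by (intro half_gaussian_moments) simp
    show "c * (0 / norm x + (norm x)\<^sup>2 / norm x ^ 3) \<le> c / norm x" if "x \<noteq> 0" for x :: "real^2"
      using sq[OF that] by simp
  qed
  have 2: "(\<integral>k. complex_of_real (\<integral>r. ?w2 k r \<partial>lborel) * \<phi> k \<partial>lborel)
    = (\<integral>r. \<integral>k. complex_of_real (?w2 k r) * \<phi> k \<partial>lborel \<partial>lborel)"
  proof (rule integral_kernel_swap[OF _ r\<phi>])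
    show "case_prod ?w2 \<in> borel_measurable (borel \<Otimes>\<^sub>M borel)" by measurable
    show "\<bar>?w2 k r\<bar> \<le> ?v2 k r" for k r
    proof -
      have "\<bar>?\<delta> / r\<^sup>2 + (- (k $ i * k $ j)) / r ^ 4\<bar> \<le> \<bar>?\<delta> / r\<^sup>2\<bar> + \<bar>(- (k $ i * k $ j)) / r ^ 4\<bar>"
        by (rule abs_triangle_ineq)
      also have "\<dots> \<le> 1 / r\<^sup>2 + (norm k)\<^sup>2 / r ^ 4"
        using divide_right_mono[OF abs_component_mult_le[of k i j], of "r ^ 4"]
        by (intro add_mono) (auto simp: abs_mult)
      finally show ?thesis
        by (simp add: abs_mult mult_left_mono mult_right_mono)
    qed
    show "has_bochner_integral lborel (?v2 k) (c * (1 / norm k + (norm k)\<^sup>2 / norm k ^ 3))" if "k \<noteq> 0" for k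
      unfolding c_def using that by (intro half_gaussian_inverse_moments) simp
    show "c * (1 / norm k + (norm k)\<^sup>2 / norm k ^ 3) \<le> (2 * c) / norm k" if "k \<noteq> 0" for k :: "real^2"
      using sq[OF that] by (simp add: mult.commute)
  qed
  have inner: "(\<integral>x. complex_of_real (?w1 x r) * fourier \<phi> x \<partial>lborel)
     = complex_of_real (2 * pi) * (\<integral>k. complex_of_real (?w2 k r) * \<phi> k \<partial>lborel)" for r
  proof (cases "r > 0")
    case True
    let ?h = "\<lambda>x::real^2. complex_of_real (x $ i * x $ j) * gaussian r x"
    have "rapidly_decreasing (\<lambda>x::real^2. complex_of_real (x $ i) * (complex_of_real (x $ j) * gaussian r x))"
      by (intro rapidly_decreasing_mult_coord rapidly_decreasing_gaussian True)
    then have h: "integrable lborel ?h"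
      by (intro rapidly_decreasing_integrable) (simp add: mult.assoc)
    have "(\<integral>x. complex_of_real (?w1 x r) * fourier \<phi> x \<partial>lborel)
       = (\<integral>x. complex_of_real (r\<^sup>2) * (fourier \<phi> x * ?h x) \<partial>lborel)"
      using True by (intro Bochner_Integration.integral_cong) (auto simp: gaussian_def mult_ac)
    also have "\<dots> = complex_of_real (r\<^sup>2) * (\<integral>k. \<phi> k * fourier ?h k \<partial>lborel)"
      by (simp only: integral_mult_right_zero integral_fourier_mult[OF rapidly_decreasing_integrable[OF r\<phi>] h])
    also have "\<dots> = (\<integral>k. complex_of_real (r\<^sup>2) * (\<phi> k * fourier ?h k) \<partial>lborel)"
      by (simp only: integral_mult_right_zero)
    also have "\<dots> = (\<integral>k. complex_of_real (2 * pi) * (complex_of_real (?w2 k r) * \<phi> k) \<partial>lborel)"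
    proof (intro Bochner_Integration.integral_cong refl)
      fix k
      have card2: "CARD(2) = 2" by simp
      have F: "fourier ?h k = complex_of_real ((sqrt (2 * pi) / r)\<^sup>2)
          * (complex_of_real (?\<delta> / r\<^sup>2 - k $ i * k $ j / r ^ 4) * gaussian (1 / r) k)"
        unfolding fourier_second_moment_gaussian[OF True] card2 by (simp only: of_real_mult mult.assoc)
      \<comment> \<open>Here the dimension enters: the weight r^2 of the superposition cancels the
        normalisation of the Gaussian transform exactly in the plane.\<close>
      have "r\<^sup>2 * (sqrt (2 * pi) / r)\<^sup>2 = 2 * pi"
        using True by (simp add: power_divide)
      then have "complex_of_real (r\<^sup>2) * complex_of_real ((sqrt (2 * pi) / r)\<^sup>2) = complex_of_real (2 * pi)"
        by (metis of_real_mult)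
      then have "complex_of_real (r\<^sup>2) * fourier ?h k
          = complex_of_real (2 * pi) * (complex_of_real (?\<delta> / r\<^sup>2 - k $ i * k $ j / r ^ 4) * gaussian (1 / r) k)"
        by (simp only: F mult.assoc[symmetric])
      then show "complex_of_real (r\<^sup>2) * (\<phi> k * fourier ?h k) = complex_of_real (2 * pi) * (complex_of_real (?w2 k r) * \<phi> k)"
        using True by (simp add: gaussian_def mult_ac)
    qed
    finally show ?thesis by (simp only: integral_mult_right_zero)
  qed simp
  have outer1: "(\<integral>x. complex_of_real (\<integral>r. ?w1 x r \<partial>lborel) * fourier \<phi> x \<partial>lborel)
      = complex_of_real (2 * pi * c) * (\<integral>x. complex_of_real (stokes_kernel i j x) * fourier \<phi> x \<partial>lborel)"
  proof -
    have "complex_of_real (\<integral>r. ?w1 x r \<partial>lborel) * fourier \<phi> x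
      = complex_of_real (2 * pi * c) * (complex_of_real (stokes_kernel i j x) * fourier \<phi> x)" for x
    proof (cases "x = 0")
      case False
      then have "(\<integral>r. ?w1 x r \<partial>lborel) = c * (0 / norm x + x $ i * x $ j / norm x ^ 3)"
        unfolding c_def by (intro has_bochner_integral_integral_eq half_gaussian_moments) simp
      also have "\<dots> = 2 * pi * c * stokes_kernel i j x"
        by (simp add: stokes_kernel_def)
      finally show ?thesis by (simp only: of_real_mult mult.assoc)
    qed (simp add: stokes_kernel_def)
    then show ?thesis by (simp only: integral_mult_right_zero)
  qed
  have outer2: "(\<integral>k. complex_of_real (\<integral>r. ?w2 k r \<partial>lborel) * \<phi> k \<partial>lborel)
      = complex_of_real c * (\<integral>k. complex_of_real (stokes_symbol i j k) * \<phi> k \<partial>lborel)"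
  proof -
    have "(\<integral>k. complex_of_real (\<integral>r. ?w2 k r \<partial>lborel) * \<phi> k \<partial>lborel)
      = (\<integral>k. complex_of_real c * (complex_of_real (stokes_symbol i j k) * \<phi> k) \<partial>lborel)"
    proof (rule integral_cong_AE)
      show "AE k in lborel. complex_of_real (\<integral>r. ?w2 k r \<partial>lborel) * \<phi> k
        = complex_of_real c * (complex_of_real (stokes_symbol i j k) * \<phi> k)"
        using AE_lborel_singleton[of "0::real^2"]
      proof eventually_elim
        case (elim k)
        then have "(\<integral>r. ?w2 k r \<partial>lborel) = c * (?\<delta> / norm k + (- (k $ i * k $ j)) / norm k ^ 3)"
          unfolding c_def by (intro has_bochner_integral_integral_eq half_gaussian_inverse_moments) simp
        also have "\<dots> = c * stokes_symbol i j k"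
          by (simp add: stokes_symbol_def)
        finally show ?case by (simp only: of_real_mult mult.assoc)
      qed
    qed (use r\<phi> in measurable)
    then show ?thesis by (simp only: integral_mult_right_zero)
  qed
  \<comment> \<open>On the left 2 pi comes from the normalisation of the kernel, on the right from
    the Gaussian transform. Their agreement is the origin of the constant 1 / (2 pi) in the
    result.\<close>
  have "complex_of_real (2 * pi * c) * (\<integral>x. complex_of_real (stokes_kernel i j x) * fourier \<phi> x \<partial>lborel)
      = complex_of_real (2 * pi * c) * (\<integral>k. complex_of_real (stokes_symbol i j k) * \<phi> k \<partial>lborel)"
    unfolding outer1[symmetric] 1 inner integral_mult_right_zero 2[symmetric] outer2 by simp
  then show ?thesis
    using c by (simp only: mult_cancel_left of_real_eq_0_iff) simp
qed

section \<open>Functions bounded by C/|x| as tempered distributions\<close>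

text \<open>A Gaussian is bounded below on a compact set, so integrability against a Gaussian
  implies local integrability.\<close>

lemma kernel_locally_integrable:
  fixes g :: "real^2 \<Rightarrow> complex"
  assumes g: "g \<in> borel_measurable borel" "\<And>x. norm (g x) \<le> C / norm x"
  shows "locally_integrable g"
  unfolding locally_integrable_def set_integrable_def
proof (intro allI impI)
  note [measurable] = g(1)
  fix K :: "(real^2) set" assume K: "compact K"
  then obtain R where R: "\<And>x. x \<in> K \<Longrightarrow> norm x \<le> R"
    using compact_imp_bounded[OF K] by (auto simp: bounded_iff)
  have [measurable]: "K \<in> sets borel" using K by (simp add: borel_compact)
  have "integrable lborel (\<lambda>x. indicator K x *\<^sub>R g x)"
  proof (rule Bochner_Integration.integrable_bound)
    show "integrable lborel (\<lambda>x. exp (R\<^sup>2 / 2) * norm (g x * gaussian 1 x))"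
      by (intro integrable_mult_right integrable_norm kernel_integrable[OF g] rapidly_decreasing_gaussian) simp
    show "AE x in lborel. norm (indicator K x *\<^sub>R g x) \<le> norm (exp (R\<^sup>2 / 2) * norm (g x * gaussian 1 x))"
    proof (rule AE_I2)
      fix x
      show "norm (indicator K x *\<^sub>R g x) \<le> norm (exp (R\<^sup>2 / 2) * norm (g x * gaussian 1 x))"
      proof (cases "x \<in> K")
        case True
        have "(norm x)\<^sup>2 \<le> R\<^sup>2" using R[OF True] by (intro power_mono) auto
        then have "1 \<le> exp (R\<^sup>2 / 2 + - ((norm x)\<^sup>2 / 2))" by simp
        then have "1 \<le> exp (R\<^sup>2 / 2) * norm (gaussian 1 x)"
          by (simp only: exp_add norm_gaussian) simp
        from mult_left_mono[OF this norm_ge_zero[of "g x"]] True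
        show ?thesis by (simp add: norm_mult mult_ac)
      qed simp
    qed
  qed measurable
  then show "integrable lebesgue (\<lambda>x. indicator K x *\<^sub>R g x)"
    by (subst integrable_completion) auto
qed

lemma kernel_integrable_lebesgue:
  fixes g \<phi> :: "real^2 \<Rightarrow> complex"
  assumes g: "g \<in> borel_measurable borel" "\<And>x. norm (g x) \<le> C / norm x" and \<phi>: "\<phi> \<in> schwartz"
  shows "integrable lebesgue (\<lambda>x. g x * \<phi> x)"
    and "(\<integral>x. g x * \<phi> x \<partial>lebesgue) = (\<integral>x. g x * \<phi> x \<partial>lborel)"
proof -
  note r = schwartz_rapidly_decreasing[OF \<phi>]
  have m: "(\<lambda>x. g x * \<phi> x) \<in> borel_measurable lborel" using g r by measurable
  show "integrable lebesgue (\<lambda>x. g x * \<phi> x)"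
    using kernel_integrable[OF g r] by (subst integrable_completion[OF m])
  show "(\<integral>x. g x * \<phi> x \<partial>lebesgue) = (\<integral>x. g x * \<phi> x \<partial>lborel)"
    by (rule integral_completion[OF m])
qed

lemma schwartz_seminorm_bound:
  assumes "\<phi> \<in> schwartz"
  shows "(1 + norm x) ^ N * norm (\<phi> x) \<le> schwartz_seminorm N [] \<phi>"
proof -
  obtain C where C: "\<And>x. (1 + norm x) ^ N * norm (\<phi> x) \<le> C"
    using schwartz_rapidly_decreasing[OF assms] by (auto simp: rapidly_decreasing_def)
  have "(1 + norm x) ^ N * norm (\<phi> x) \<le> (SUP x. (1 + norm x) ^ N * norm (\<phi> x))"
    by (rule cSUP_upper) (auto intro!: bdd_aboveI2 C)
  then show ?thesis by (simp add: schwartz_seminorm_def)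
qed

text \<open>The pairing is bounded by a multiple of a single seminorm, with weight exponent 4 and no
  derivatives. For a linear functional, one subbasic neighbourhood around each point then proves
  continuity.\<close>

lemma kernel_tempered_distribution:
  fixes g :: "real^2 \<Rightarrow> complex"
  assumes g: "g \<in> borel_measurable borel" "\<And>x. norm (g x) \<le> C / norm x"
  shows "tempered_distribution (\<lambda>\<phi>. \<integral>x. g x * \<phi> x \<partial>lebesgue)"
proof -
  let ?T = "\<lambda>\<phi>. \<integral>x. g x * \<phi> x \<partial>lebesgue"
  note int = kernel_integrable_lebesgue[OF g]
  have add: "?T (\<lambda>x. \<phi> x + \<psi> x) = ?T \<phi> + ?T \<psi>" if "\<phi> \<in> schwartz" "\<psi> \<in> schwartz" for \<phi> \<psi>
    unfolding distrib_left by (intro Bochner_Integration.integral_add int that)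
  have mult: "?T (\<lambda>x. c * \<phi> x) = c * ?T \<phi>" for c \<phi>
    by (simp add: mult.left_commute[of _ c])
  define M where "M = \<bar>C\<bar> * (\<integral>x. 1 / norm x * (1 / (1 + norm x) ^ 4) \<partial>(lborel :: (real^2) measure))"
  have M: "M \<ge> 0" unfolding M_def by (intro mult_nonneg_nonneg integral_nonneg) auto
  have bound: "norm (?T \<phi>) \<le> M * schwartz_seminorm 4 [] \<phi>" if \<phi>: "\<phi> \<in> schwartz" for \<phi>
  proof -
    let ?s = "schwartz_seminorm 4 [] \<phi>"
    have "norm (?T \<phi>) \<le> (\<integral>x. (\<bar>C\<bar> * ?s) * (1 / norm x * (1 / (1 + norm x) ^ 4)) \<partial>(lborel :: (real^2) measure))"
      unfolding int(2)[OF \<phi>]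
    proof (rule Bochner_Integration.integral_norm_bound_integral)
      show "integrable lborel (\<lambda>x. g x * \<phi> x)"
        by (intro kernel_integrable[OF g] schwartz_rapidly_decreasing \<phi>)
      show "integrable lborel (\<lambda>x::real^2. (\<bar>C\<bar> * ?s) * (1 / norm x * (1 / (1 + norm x) ^ 4)))"
        by (intro integrable_mult_right integrable_norm_kernel)
      fix x :: "real^2"
      have p: "0 < (1 + norm x) ^ 4" by (intro zero_less_power) (simp add: add_pos_nonneg)
      have s: "norm (\<phi> x) \<le> ?s / (1 + norm x) ^ 4"
        using schwartz_seminorm_bound[OF \<phi>, of x 4] p by (simp add: le_divide_eq mult.commute)
      have "C / norm x \<le> \<bar>C\<bar> / norm x" by (intro divide_right_mono) auto
      with g(2)[of x] have "norm (g x) \<le> \<bar>C\<bar> / norm x" by linarith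
      from mult_mono[OF this s] show "norm (g x * \<phi> x) \<le> (\<bar>C\<bar> * ?s) * (1 / norm x * (1 / (1 + norm x) ^ 4))"
        by (simp add: norm_mult)
    qed
    then show ?thesis unfolding integral_mult_right_zero by (simp only: M_def mult_ac)
  qed
  have "continuous_map schwartz_topology euclidean ?T"
    unfolding continuous_map_def
  proof (intro conjI allI impI)
    fix U :: "complex set" assume "openin euclidean U"
    then have U: "open U" by simp
    show "openin schwartz_topology {\<phi> \<in> topspace schwartz_topology. ?T \<phi> \<in> U}"
    proof (subst openin_subopen, rule ballI)
      fix \<phi> assume "\<phi> \<in> {\<phi> \<in> topspace schwartz_topology. ?T \<phi> \<in> U}"
      then have \<phi>: "\<phi> \<in> schwartz" and "?T \<phi> \<in> U"
        by (auto simp: schwartz_topology_def)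
      with U obtain e where e: "e > 0" "ball (?T \<phi>) e \<subseteq> U"
        using open_contains_ball by blast
      \<comment> \<open>\<open>M\<close> may vanish; \<open>M + 1\<close> keeps the radius well
        defined and makes M e / (M + 1) strictly less than e.\<close>
      define B where "B = {\<psi> \<in> schwartz. schwartz_seminorm 4 [] (\<lambda>x. \<psi> x - \<phi> x) < e / (M + 1)}"
      have "e / (M + 1) > 0" using e M by simp
      then have B: "openin schwartz_topology B"
        unfolding schwartz_topology_def B_def using \<phi>
        by (intro topology_generated_by_Basis CollectI exI[of _ 4] exI[of _ "[]"] exI[of _ \<phi>] exI[of _ "e / (M + 1)"])
          simp
      moreover have "\<phi> \<in> B"
        using \<phi> \<open>e / (M + 1) > 0\<close> by (simp add: B_def schwartz_seminorm_def)
      moreover have "B \<subseteq> {\<phi> \<in> topspace schwartz_topology. ?T \<phi> \<in> U}"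
      proof
        fix \<psi> assume \<psi>B: "\<psi> \<in> B"
        then have \<psi>: "\<psi> \<in> schwartz" and less: "schwartz_seminorm 4 [] (\<lambda>x. \<psi> x - \<phi> x) < e / (M + 1)"
          by (auto simp: B_def)
        have "?T \<psi> = ?T (\<lambda>x. \<phi> x + (\<psi> x - \<phi> x))" by simp
        also have "\<dots> = ?T \<phi> + ?T (\<lambda>x. \<psi> x - \<phi> x)"
          by (intro add \<phi> \<psi> schwartz_diff)
        finally have "dist (?T \<phi>) (?T \<psi>) = norm (?T (\<lambda>x. \<psi> x - \<phi> x))"
          by (simp add: dist_norm)
        also have "\<dots> \<le> M * schwartz_seminorm 4 [] (\<lambda>x. \<psi> x - \<phi> x)"
          by (intro bound schwartz_diff \<phi> \<psi>)
        also have "\<dots> \<le> M * (e / (M + 1))"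
          using less M by (intro mult_left_mono) auto
        also have "\<dots> < e"
          using e M by (simp add: field_simps)
        finally have "?T \<psi> \<in> U" using e by auto
        then show "\<psi> \<in> {\<phi> \<in> topspace schwartz_topology. ?T \<phi> \<in> U}"
          using openin_subset[OF B] \<psi>B by auto
      qed
      ultimately show "\<exists>T. openin schwartz_topology T \<and> \<phi> \<in> T \<and> T \<subseteq> {\<phi> \<in> topspace schwartz_topology. ?T \<phi> \<in> U}"
        by blast
    qed
  qed auto
  then show ?thesis
    using add mult by (simp add: tempered_distribution_def)
qed

section \<open>The linear system at a fixed frequency and the conclusion\<close>

text \<open>Pairing the first two equations with k eliminates u by the divergence condition and
  determines p; substituting p back determines u. The only link between \<open>n\<close> and k is
  the quadratic relation, so this is algebra over the complex numbers.\<close>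

lemma fourier_system_components_iff:
  fixes n k1 k2 u1 u2 p f1 f2 :: complex
  assumes n: "n \<noteq> 0" "n\<^sup>2 = k1\<^sup>2 + k2\<^sup>2"
  shows "\<i> * p * k1 = - (n * u1) + f1 \<and> \<i> * p * k2 = - (n * u2) + f2 \<and> u1 * k1 + u2 * k2 = 0 \<longleftrightarrow>
    u1 = (1 / n - k1 * k1 / n ^ 3) * f1 + (- (k1 * k2 / n ^ 3)) * f2 \<and>
    u2 = (- (k2 * k1 / n ^ 3)) * f1 + (1 / n - k2 * k2 / n ^ 3) * f2 \<and>
    p = - \<i> * (f1 * k1 + f2 * k2) / n\<^sup>2" (is "?L \<longleftrightarrow> ?R")
proof -
  let ?S = "f1 * k1 + f2 * k2"
  \<comment> \<open>Denominators are cleared once, after which both directions are polynomial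
    identities.\<close>
  have R: "?R \<longleftrightarrow> n ^ 3 * u1 = n\<^sup>2 * f1 - ?S * k1 \<and> n ^ 3 * u2 = n\<^sup>2 * f2 - ?S * k2 \<and> n\<^sup>2 * p = - \<i> * ?S"
    (is "_ \<longleftrightarrow> ?R'")
  proof -
    have clear: "u = (1 / n - a / n ^ 3) * f + (- (b / n ^ 3)) * g \<longleftrightarrow> n ^ 3 * u = n\<^sup>2 * f - (a * f + b * g)" for u a b f g
    proof -
      have "n ^ 3 * ((1 / n - a / n ^ 3) * f + (- (b / n ^ 3)) * g) = n\<^sup>2 * f - (a * f + b * g)"
        using n(1) by (simp add: algebra_simps power2_eq_square power3_eq_cube)
      then show ?thesis using n(1) by (metis mult_cancel_left power_not_zero)
    qed
    have "u1 = (1 / n - k1 * k1 / n ^ 3) * f1 + (- (k1 * k2 / n ^ 3)) * f2 \<longleftrightarrow> n ^ 3 * u1 = n\<^sup>2 * f1 - ?S * k1"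
      unfolding clear by (simp add: algebra_simps)
    moreover have "u2 = (- (k2 * k1 / n ^ 3)) * f1 + (1 / n - k2 * k2 / n ^ 3) * f2 \<longleftrightarrow> n ^ 3 * u2 = n\<^sup>2 * f2 - ?S * k2"
      unfolding add.commute[of "_ * f1"] clear by (simp add: algebra_simps)
    moreover have "p = - \<i> * ?S / n\<^sup>2 \<longleftrightarrow> n\<^sup>2 * p = - \<i> * ?S"
      using n(1) by (auto simp: field_simps)
    ultimately show ?thesis by simp
  qed
  have "?L \<longleftrightarrow> ?R'"
  proof
    assume L: ?L
    then have eqs: "\<i> * p * k1 = - (n * u1) + f1" "\<i> * p * k2 = - (n * u2) + f2"
      by blast+
    have S: "\<i> * p * n\<^sup>2 = ?S"
    proof -
      have "\<i> * p * n\<^sup>2 = (\<i> * p * k1) * k1 + (\<i> * p * k2) * k2"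
        unfolding n(2) by (simp add: power2_eq_square algebra_simps)
      also have "\<dots> = ?S - n * (u1 * k1 + u2 * k2)"
        unfolding eqs by (simp add: algebra_simps)
      finally show ?thesis using L by simp
    qed
    have p: "n\<^sup>2 * p = - \<i> * ?S"
      unfolding S[symmetric] by (simp add: algebra_simps)
    have "n ^ 3 * u = n\<^sup>2 * f - ?S * k" if "\<i> * p * k = - (n * u) + f" for u f k
    proof -
      have nu: "n * u = f - \<i> * p * k" using that by simp
      have "n\<^sup>2 * (n * u) = n\<^sup>2 * f - (\<i> * p * n\<^sup>2) * k"
        unfolding nu by (simp add: algebra_simps)
      then show ?thesis unfolding S by (simp add: power2_eq_square power3_eq_cube mult_ac)
    qed
    with L p show ?R' by blast
  next
    assume R: ?R'
    then have nu: "n ^ 3 * u1 = n\<^sup>2 * f1 - ?S * k1" "n ^ 3 * u2 = n\<^sup>2 * f2 - ?S * k2"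
      and np: "n\<^sup>2 * p = - \<i> * ?S" by blast+
    have S: "\<i> * (n\<^sup>2 * p) = ?S" unfolding np by simp
    have eq: "\<i> * p * k = - (n * u) + f" if "n ^ 3 * u = n\<^sup>2 * f - ?S * k" for u f k
    proof -
      have "n\<^sup>2 * (\<i> * p * k) = n\<^sup>2 * (- (n * u) + f)"
        using that unfolding S[symmetric] by (simp add: power2_eq_square power3_eq_cube algebra_simps)
      then show ?thesis using n(1) by simp
    qed
    \<comment> \<open>The two contributions cancel because k1^2 + k2^2 = n^2: the matrix takes
      values orthogonal to k.\<close>
    have "n ^ 3 * (u1 * k1 + u2 * k2) = (n ^ 3 * u1) * k1 + (n ^ 3 * u2) * k2"
      by (simp add: algebra_simps)
    also have "\<dots> = n\<^sup>2 * ?S - ?S * (k1\<^sup>2 + k2\<^sup>2)"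
      unfolding nu by (simp add: power2_eq_square algebra_simps)
    also have "\<dots> = 0" unfolding n(2)[symmetric] by simp
    finally have "u1 * k1 + u2 * k2 = 0" using n(1) by simp
    with R eq show ?L by blast
  qed
  with R show ?thesis by blast
qed

definition stokes_matrix :: "real^2 \<Rightarrow> complex^2^2" where
  "stokes_matrix k = (\<chi> i j. complex_of_real (stokes_symbol i j k))"

lemma fourier_system_iff:
  assumes "k \<noteq> 0"
  shows "fourier_system k f u p \<longleftrightarrow>
    u = stokes_matrix k *v f \<and> p = - \<i> * (f $ 1 * cvec k $ 1 + f $ 2 * cvec k $ 2) / (complex_of_real (norm k))\<^sup>2"
proof -
  have n: "complex_of_real (norm k) \<noteq> 0" using assms by simp
  have "(norm k)\<^sup>2 = (k $ 1)\<^sup>2 + (k $ 2)\<^sup>2"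
    unfolding power2_norm_eq_inner by (simp add: inner_vec_def sum_2 power2_eq_square)
  then have n2: "(complex_of_real (norm k))\<^sup>2 = (cvec k $ 1)\<^sup>2 + (cvec k $ 2)\<^sup>2"
    by (simp add: cvec_def flip: of_real_power of_real_add)
  have 12: "(1::2) \<noteq> 2" "(2::2) \<noteq> 1" by simp_all
  show ?thesis
    using fourier_system_components_iff[OF n n2, of p "u $ 1" "f $ 1" "u $ 2" "f $ 2"]
    by (simp add: fourier_system_def vec_eq_iff forall_2 sum_2 matrix_vector_mult_def stokes_matrix_def
        stokes_symbol_def cvec_def)
qed

lemma solution_symbol_stokes_matrix: "solution_symbol stokes_matrix"
  unfolding solution_symbol_def
proof (intro allI impI conjI)
  fix k :: "real^2" and f :: "complex^2" assume k: "k \<noteq> 0"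
  show "\<exists>!(u, p). fourier_system k f u p"
    by (auto simp: fourier_system_iff[OF k])
  show "u = stokes_matrix k *v f" if "fourier_system k f u p" for u p
    using that by (simp add: fourier_system_iff[OF k])
qed

text \<open>The system is solvable for every right-hand side, so the action of the matrix on every
  vector is prescribed.\<close>

lemma solution_symbol_unique:
  assumes "solution_symbol \<sigma>" "k \<noteq> 0"
  shows "\<sigma> k = stokes_matrix k"
proof -
  have "\<sigma> k *v f = stokes_matrix k *v f" for f
    using assms fourier_system_iff[OF assms(2)] unfolding solution_symbol_def by metis
  then show ?thesis by (simp add: matrix_eq)
qed

text \<open>A functional carries meaning only on Schwartz functions, so uniqueness takes the form of
  a claim about every admissible \<open>E\<close>; the existence clause keeps that claim from being
  vacuous.\<close>

theorem lemma3p3: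
  "(\<exists>E. fundamental_solution_tensor E) \<and>
   (\<forall>E. fundamental_solution_tensor E \<longrightarrow>
      (\<forall>i j. given_by_function (E $ i $ j)
         (\<lambda>x. complex_of_real (((1 / (2 * pi * norm x ^ 3)) *\<^sub>R outer_product x x) $ i $ j))))"
proof -
  have kernel_eq: "(\<lambda>x. complex_of_real (((1 / (2 * pi * norm x ^ 3)) *\<^sub>R outer_product x x) $ i $ j))
    = (\<lambda>x. complex_of_real (stokes_kernel i j x))" for i j :: 2
    by (simp add: fun_eq_iff outer_product_def stokes_kernel_def)
  have K: "(\<lambda>x::real^2. complex_of_real (stokes_kernel i j x)) \<in> borel_measurable borel"
    "\<And>x::real^2. norm (complex_of_real (stokes_kernel i j x)) \<le> (1 / (2 * pi)) / norm x" for i j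
    using abs_stokes_kernel_le by (measurable, simp only: norm_of_real)
  have S: "(\<lambda>k::real^2. complex_of_real (stokes_symbol i j k)) \<in> borel_measurable borel"
    "\<And>k::real^2. norm (complex_of_real (stokes_symbol i j k)) \<le> 2 / norm k" for i j
    using abs_stokes_symbol_le by (measurable, simp only: norm_of_real)
  have pairing: "(\<integral>x. complex_of_real (stokes_kernel i j x) * fourier \<phi> x \<partial>lebesgue)
      = (\<integral>k. complex_of_real (stokes_symbol i j k) * \<phi> k \<partial>lebesgue)"
    if "\<phi> \<in> schwartz" for i j and \<phi> :: "real^2 \<Rightarrow> complex"
    by (simp only: kernel_integrable_lebesgue(2)[OF K schwartz_fourier[OF that]]
        kernel_integrable_lebesgue(2)[OF S that] fourier_stokes_kernel[OF that])
  show ?thesis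
  proof (intro conjI allI impI)
    define E :: "2 functional^2^2" where
      "E = (\<chi> i j. (\<lambda>\<phi>. (\<integral>x. complex_of_real (stokes_kernel i j x) * \<phi> x \<partial>lebesgue)))"
    have "fundamental_solution_tensor E"
      unfolding fundamental_solution_tensor_def
    proof (intro conjI allI exI)
      show "tempered_distribution (E $ i $ j)" for i j
        unfolding E_def using kernel_tempered_distribution[OF K] by simp
      show "solution_symbol stokes_matrix" by (rule solution_symbol_stokes_matrix)
      show "given_by_function (fourier_distribution (E $ i $ j)) (\<lambda>k. stokes_matrix k $ i $ j)" for i j
        using kernel_locally_integrable[OF S] kernel_integrable_lebesgue(1)[OF S] pairing
        by (simp add: given_by_function_def stokes_matrix_def fourier_distribution_def E_def)
    qed
    then show "\<exists>E. fundamental_solution_tensor E" by blast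
  next
    fix E :: "2 functional^2^2" and i j :: 2
    assume "fundamental_solution_tensor E"
    then obtain \<sigma> where \<sigma>: "solution_symbol \<sigma>"
      and E: "given_by_function (fourier_distribution (E $ i $ j)) (\<lambda>k. \<sigma> k $ i $ j)"
      unfolding fundamental_solution_tensor_def by blast
    have "(E $ i $ j) \<psi> = (\<integral>x. complex_of_real (stokes_kernel i j x) * \<psi> x \<partial>lebesgue)" if \<psi>: "\<psi> \<in> schwartz" for \<psi>
    proof -
      \<comment> \<open>The hypothesis controls \<open>E\<close> only on Fourier transforms of test
        functions; surjectivity makes these all test functions.\<close>
      obtain \<phi> where \<phi>: "\<phi> \<in> schwartz" "fourier \<phi> = \<psi>"
        using schwartz_fourier_surj[OF \<psi>] by blast
      have int: "integrable lebesgue (\<lambda>k. \<sigma> k $ i $ j * \<phi> k)"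
        and eq: "(E $ i $ j) \<psi> = (\<integral>k. \<sigma> k $ i $ j * \<phi> k \<partial>lebesgue)"
        using E \<phi> unfolding given_by_function_def fourier_distribution_def by auto
      note eq
      \<comment> \<open>The value of \<sigma> at 0 is arbitrary, but the origin is a null set.
        Measurability of the integrand with \<sigma> comes from \<open>int\<close>.\<close>
      also have "(\<integral>k. \<sigma> k $ i $ j * \<phi> k \<partial>lebesgue) = (\<integral>k. complex_of_real (stokes_symbol i j k) * \<phi> k \<partial>lebesgue)"
      proof (rule integral_cong_AE)
        have "AE k in lebesgue. k \<noteq> (0::real^2)"
          by (rule AE_completion[OF AE_lborel_singleton])
        then show "AE k in lebesgue. \<sigma> k $ i $ j * \<phi> k = complex_of_real (stokes_symbol i j k) * \<phi> k"
          by eventually_elim (simp add: solution_symbol_unique[OF \<sigma>] stokes_matrix_def)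
      qed (use int kernel_integrable_lebesgue(1)[OF S \<phi>(1)] in auto)
      also have "\<dots> = (\<integral>x. complex_of_real (stokes_kernel i j x) * \<psi> x \<partial>lebesgue)"
        using pairing[OF \<phi>(1)] \<phi>(2) by simp
      finally show ?thesis .
    qed
    then show "given_by_function (E $ i $ j)
         (\<lambda>x. complex_of_real (((1 / (2 * pi * norm x ^ 3)) *\<^sub>R outer_product x x) $ i $ j))"
      unfolding kernel_eq given_by_function_def
      using kernel_locally_integrable[OF K] kernel_integrable_lebesgue(1)[OF K] by blast
  qed
qed

end
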